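(* Let $\sigma=(\sigma(i))_{i\ge1}$ be an infinite increasing sequence of positive even integers and let $G$ be an $n$-vertex graph containing no cycle of length $\sigma(i)$ for any $i\ge1$. Then the average degree of $G$ is at most \[ \inf_{\pi<\sigma,\ r\ge1} \exp\left(6r + \sum_{i=1}^{r}\frac{2\log \Delta(i)}{\pi(i-1)} + \frac{2\log n}{\pi(r)}\right),\] where the infimum is over all infinite subsequences $\pi=(\pi(i))_{i\ge1}$ of $\sigma$ and all integers $r\ge1$, and where $\pi(0):=1$, $\Delta(1):=\pi(1)$, and $\Delta(i):=\max\{\sigma(j)-\sigma(j-1) : j\ge2,\ \sigma(j)\le \pi(i)\}$ for $i\ge2$.
   Context: All logarithms are natural logarithms. $\pi<\sigma$ means $\pi$ is a subsequence of $\sigma$. The average degree of $G$ is $2|E(G)|/|V(G)|$. *)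

theory Defs
  imports Complex_Main
begin

definition simple_graph :: "'a set \<Rightarrow> 'a set set \<Rightarrow> bool" where
  "simple_graph V E \<longleftrightarrow> finite V \<and> (\<forall>e\<in>E. e \<subseteq> V \<and> card e = 2)"

definition average_degree :: "'a set \<Rightarrow> 'a set set \<Rightarrow> real" where
  "average_degree V E = 2 * real (card E) / real (card V)"

(* The list enumerates the vertices once around the cycle. Cycles have length at least 3,
   so no simple graph has a cycle of length 2. *)
definition is_cycle :: "'a set set \<Rightarrow> 'a list \<Rightarrow> bool" where
  "is_cycle E c \<longleftrightarrow> length c \<ge> 3 \<and> distinct c \<and>
     (\<forall>i<length c. {c ! i, c ! (Suc i mod length c)} \<in> E)"

definition has_cycle_of_length :: "'a set set \<Rightarrow> nat \<Rightarrow> bool" where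
  "has_cycle_of_length E k \<longleftrightarrow> (\<exists>c. is_cycle E c \<and> length c = k)"

(* Sequences are indexed by the positive integers; their value at 0 is never used. *)
definition infinite_subsequence :: "(nat \<Rightarrow> nat) \<Rightarrow> (nat \<Rightarrow> nat) \<Rightarrow> bool" where
  "infinite_subsequence \<pi> \<sigma> \<longleftrightarrow>
     (\<exists>f. strict_mono_on {1..} f \<and> (\<forall>i\<ge>1. f i \<ge> (1::nat) \<and> \<pi> i = \<sigma> (f i)))"

(* For i >= 2, with sigma strictly increasing and pi a subsequence of it, the maximum is over
   a finite nonempty set, and the natural-number differences are not truncated. *)
definition Delta :: "(nat \<Rightarrow> nat) \<Rightarrow> (nat \<Rightarrow> nat) \<Rightarrow> nat \<Rightarrow> nat" where
  "Delta \<sigma> \<pi> i =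
     (if i = 1 then \<pi> 1 else Max {\<sigma> j - \<sigma> (j - 1) | j. j \<ge> 2 \<and> \<sigma> j \<le> \<pi> i})"

(* The update at 0 is the convention pi(0) := 1. *)
definition degree_bound :: "nat \<Rightarrow> (nat \<Rightarrow> nat) \<Rightarrow> (nat \<Rightarrow> nat) \<Rightarrow> nat \<Rightarrow> real" where
  "degree_bound n \<sigma> \<pi> r =
     exp (6 * real r
          + (\<Sum>i=1..r. 2 * ln (real (Delta \<sigma> \<pi> i)) / real ((\<pi>(0 := 1)) (i - 1)))
          + 2 * ln (real n) / real (\<pi> r))"

end

theory Submission
  imports Defs
begin

text \<open>Induction on \<open>r\<close>. The bound for \<open>r\<close> and \<open>n\<close> is \<open>exp 6 * D * n powr (2 / \<pi> r)\<close>, where \<open>D\<close> is the bound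
  for \<open>r - 1\<close> and \<open>\<Delta>(r)\<close> in place of \<open>n\<close>. So one may assume that all subgraphs on at most \<open>\<Delta>(r)\<close>
  vertices have average degree at most \<open>D\<close> (for at most \<open>\<pi> 1\<close> vertices this is trivial as \<open>\<pi> 1 \<le> D\<close>).
  If the average degree is larger than claimed, pass to a bipartite subgraph of large minimum degree
  and run breadth-first search. As the layers cannot grow by the factor \<open>n powr (2 / \<pi> r)\<close>
  in each of the first \<open>\<pi> r / 2\<close> steps, two consecutive layers in this range span
  a subgraph of average degree much larger than \<open>D\<close>. Local sparsity makes it expand, and Posa's
  rotations give a cycle with a chord on more than \<open>\<Delta>(r)\<close> vertices. The search tree splits the
  vertices of this cycle in the upper layer into two classes \<open>A\<close>, \<open>B\<close>
  such that any two vertices from different classes are joined through the tree by a path of the same length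
  \<open>2 * m\<close>, and a cycle with a chord contains paths of all short even lengths from \<open>A\<close> to \<open>B\<close>. The
  resulting cycles have all even lengths in an interval that meets \<open>\<sigma>\<close>.\<close>

subsection \<open>Minimum degree, maximum cuts and breadth-first search\<close>

definition degree :: "'a set set \<Rightarrow> 'a \<Rightarrow> nat" where
  "degree E v = card {e \<in> E. v \<in> e}"

lemma simple_graph_finite_edges: "simple_graph V E \<Longrightarrow> finite E"
  unfolding simple_graph_def by (meson Pow_iff finite_Pow_iff finite_subset subsetI)

lemma simple_graph_subgraph:
  "simple_graph V E \<Longrightarrow> W \<subseteq> V \<Longrightarrow> F \<subseteq> {e \<in> E. e \<subseteq> W} \<Longrightarrow> simple_graph W F"
  unfolding simple_graph_def by (auto intro: finite_subset)

lemma simple_graph_edge: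
  assumes "simple_graph V E" "e \<in> E" "v \<in> e"
  obtains u where "e = {v, u}" "u \<noteq> v" "u \<in> V" "v \<in> V"
proof -
  have "card e = 2" "e \<subseteq> V" using assms unfolding simple_graph_def by auto
  then obtain a b where "e = {a, b}" "a \<noteq> b" by (auto simp: card_2_iff)
  with assms(3) \<open>e \<subseteq> V\<close> show thesis by (cases "v = a") (auto intro!: that)
qed

lemma simple_graph_edge_vertices:
  "simple_graph V E \<Longrightarrow> {u, v} \<in> E \<Longrightarrow> u \<in> V \<and> v \<in> V \<and> u \<noteq> v"
  unfolding simple_graph_def by (force simp: card_2_iff)

lemma handshake:
  assumes "simple_graph V E"
  shows "(\<Sum>v\<in>V. degree E v) = 2 * card E"
proof -
  have "card {v \<in> V. v \<in> e} = 2" if "e \<in> E" for e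
  proof -
    have "{v \<in> V. v \<in> e} = e" using that assms unfolding simple_graph_def by auto
    then show ?thesis using that assms unfolding simple_graph_def by simp
  qed
  then show ?thesis unfolding degree_def
    using assms simple_graph_finite_edges[OF assms]
    by (intro sum_multicount) (auto simp: simple_graph_def)
qed

text \<open>Take a smallest nonempty \<open>W\<close> that spans at least \<open>c * card W\<close>
  edges. Deleting a vertex of degree below \<open>c\<close> would lose fewer than \<open>c\<close>
  edges, so the smaller set would qualify as well.\<close>

lemma dense_graph_has_min_degree_subgraph:
  fixes c :: real
  assumes G: "simple_graph V E" and "V \<noteq> {}" and c: "c * card V \<le> card E"
  obtains W where "W \<subseteq> V" "W \<noteq> {}" "\<And>v. v \<in> W \<Longrightarrow> c \<le> degree {e \<in> E. e \<subseteq> W} v"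
proof -
  let ?P = "\<lambda>W. W \<subseteq> V \<and> W \<noteq> {} \<and> c * card W \<le> card {e \<in> E. e \<subseteq> W}"
  have "{e \<in> E. e \<subseteq> V} = E" using G unfolding simple_graph_def by auto
  then have "?P V" using assms by simp
  then obtain W where W: "?P W" and min: "\<And>U. ?P U \<Longrightarrow> card W \<le> card U"
    using ex_has_least_nat[of ?P V card] by blast
  have finW: "finite W" using W G unfolding simple_graph_def by (auto intro: finite_subset)
  have "c \<le> degree {e \<in> E. e \<subseteq> W} v" if v: "v \<in> W" for v
  proof (rule ccontr)
    assume less: "\<not> ?thesis"
    let ?F = "{e \<in> E. e \<subseteq> W}" and ?F' = "{e \<in> E. e \<subseteq> W - {v}}"
    have finF: "finite ?F" using simple_graph_finite_edges[OF G] by simp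
    have "card ?F = card (?F' \<union> {e \<in> ?F. v \<in> e})" by (rule arg_cong[of _ _ card]) auto
    also have "\<dots> = card ?F' + degree ?F v" unfolding degree_def
      using finF by (subst card_Un_disjoint) (auto intro: finite_subset[OF _ finF])
    finally have F: "card ?F = card ?F' + degree ?F v" .
    have cW: "real (card W) = card (W - {v}) + 1"
      using card_Suc_Diff1[OF finW v] by linarith
    have gt: "c * card (W - {v}) < card ?F'"
      using W less unfolding F cW by (simp add: algebra_simps)
    \<comment> \<open>The strict inequality \<open>gt\<close> excludes a single-vertex
      \<open>W\<close>: for the empty set it would read 0 < 0.\<close>
    have "W - {v} \<noteq> {}"
    proof
      assume empty: "W - {v} = {}"
      have "?F' = {}" using G unfolding empty simple_graph_def by auto
      then have "card ?F' = 0" by (metis card.empty)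
      moreover have "c * card (W - {v}) = 0" unfolding empty by simp
      ultimately show False using gt by linarith
    qed
    then have "card W \<le> card (W - {v})" using W gt by (intro min) auto
    then show False using v finW by (metis card_Diff1_less not_less)
  qed
  with W show thesis using that by blast
qed

text \<open>Moving \<open>v\<close> to the other side exchanges the cut and uncut edges at
  \<open>v\<close> and affects no other edge, so in a cut with the most edges at least half of the
  edges at every vertex are cut.\<close>

lemma maximum_cut:
  assumes G: "simple_graph V E"
  obtains A where "\<And>v. degree E v \<le> 2 * degree {e \<in> E. card (e \<inter> A) = 1} v"
proof -
  let ?F = "\<lambda>A. {e \<in> E. card (e \<inter> A) = 1}"
  have finE: "finite E" using simple_graph_finite_edges[OF G] .
  obtain A where A: "\<And>B. card (?F B) \<le> card (?F A)"
    using ex_has_greatest_nat[of "\<lambda>_. True" "{}" "\<lambda>A. card (?F A)" "Suc (card E)"] finE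
    by (auto simp: card_mono less_Suc_eq_le)
  have "degree E v \<le> 2 * degree (?F A) v" for v
  proof -
    define B where "B = (if v \<in> A then A - {v} else insert v A)"
    let ?c = "{e \<in> ?F A. v \<in> e}" and ?u = "{e \<in> E. v \<in> e} - ?F A"
    have flip: "card (e \<inter> B) = 1 \<longleftrightarrow> card (e \<inter> A) \<noteq> 1" if e: "e \<in> E" "v \<in> e" for e
    proof -
      obtain u where u: "e = {v, u}" "u \<noteq> v" using simple_graph_edge[OF G e] by metis
      show ?thesis unfolding B_def u using u(2)
        by (cases "u \<in> A"; cases "v \<in> A") (auto simp: Int_insert_left)
    qed
    have same: "e \<inter> B = e \<inter> A" if "v \<notin> e" for e
      using that unfolding B_def by auto
    have "?F B = (?F A - ?c) \<union> ?u"
    proof (rule set_eqI)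
      fix e show "e \<in> ?F B \<longleftrightarrow> e \<in> (?F A - ?c) \<union> ?u"
        using flip[of e] same[of e] by (cases "v \<in> e") auto
    qed
    then have "card (?F B) = card (?F A - ?c) + card ?u"
      using finE by (simp add: card_Un_disjoint disjoint_iff)
    also have "card (?F A - ?c) = card (?F A) - card ?c"
      using finE by (intro card_Diff_subset) auto
    finally have "card ?u \<le> card ?c"
      using A[of B] card_mono[of "?F A" ?c] finE by auto
    moreover have "degree E v \<le> card ?c + card ?u" unfolding degree_def
      by (rule order.trans[OF card_mono card_Un_le]) (use finE in auto)
    ultimately show ?thesis unfolding degree_def by simp
  qed
  with that show thesis by blast
qed

section \<open>Breadth-first search layers\<close>

fun bfs_ball :: "'a set set \<Rightarrow> 'a \<Rightarrow> nat \<Rightarrow> 'a set" where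
  "bfs_ball E z 0 = {z}"
| "bfs_ball E z (Suc i) = bfs_ball E z i \<union> {u. \<exists>v \<in> bfs_ball E z i. {v, u} \<in> E}"

text \<open>The sphere of radius \<open>i\<close> about \<open>z\<close>. The case
  \<open>i = 0\<close> is separate because \<open>i - 1\<close> would again be 0 and the layer would
  be empty.\<close>

definition bfs_layer :: "'a set set \<Rightarrow> 'a \<Rightarrow> nat \<Rightarrow> 'a set" where
  "bfs_layer E z i = bfs_ball E z i - (if i = 0 then {} else bfs_ball E z (i - 1))"

lemma bfs_layer_0 [simp]: "bfs_layer E z 0 = {z}"
  by (simp add: bfs_layer_def)

lemma bfs_layer_Suc: "bfs_layer E z (Suc i) = bfs_ball E z (Suc i) - bfs_ball E z i"
  unfolding bfs_layer_def by simp

lemma bfs_ball_mono: "i \<le> j \<Longrightarrow> bfs_ball E z i \<subseteq> bfs_ball E z j"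
  by (induction j) (auto simp: le_Suc_eq)

lemma bfs_layer_disjoint:
  assumes "u \<in> bfs_layer E z i" "u \<in> bfs_layer E z j"
  shows "i = j"
proof -
  have False if "i < j" "u \<in> bfs_layer E z i" "u \<in> bfs_layer E z j" for i j
  proof -
    have "i \<le> j - 1" using that(1) by simp
    then show False using that bfs_ball_mono[of i "j - 1" E z] unfolding bfs_layer_def by auto
  qed
  then show ?thesis using assms by (metis linorder_neqE_nat)
qed

lemma bfs_ball_subset: "simple_graph V E \<Longrightarrow> z \<in> V \<Longrightarrow> bfs_ball E z i \<subseteq> V"
  by (induction i) (auto dest: simple_graph_edge_vertices)

lemma bfs_layer_subset: "simple_graph V E \<Longrightarrow> z \<in> V \<Longrightarrow> bfs_layer E z i \<subseteq> V"
  using bfs_ball_subset unfolding bfs_layer_def by (metis Diff_subset order.trans)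

lemma bfs_layer_parent:
  assumes "u \<in> bfs_layer E z (Suc i)"
  shows "\<exists>v \<in> bfs_layer E z i. {u, v} \<in> E"
proof -
  obtain v where v: "v \<in> bfs_ball E z i" "{v, u} \<in> E" and u: "u \<notin> bfs_ball E z i"
    using assms unfolding bfs_layer_Suc by auto
  have "v \<in> bfs_layer E z i"
  proof (cases i)
    case (Suc j)
    then show ?thesis using v u unfolding Suc bfs_layer_Suc by auto
  qed (use v in simp)
  with v show ?thesis by (auto simp: insert_commute)
qed

text \<open>The distance from \<open>z\<close> changes by at most 1 along an edge: if
  \<open>u\<close> lay in the ball of radius \<open>i - 2\<close>, then \<open>v\<close> would lie
  in the ball of radius \<open>i - 1\<close>.\<close>

lemma bfs_layer_neighbour:
  assumes "v \<in> bfs_layer E z i" "{v, u} \<in> E"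
  shows "u \<in> bfs_layer E z (Suc i) \<or> u \<in> bfs_layer E z i \<or> (\<exists>j. i = Suc j \<and> u \<in> bfs_layer E z j)"
proof (cases i)
  case 0
  then show ?thesis using assms unfolding bfs_layer_Suc by auto
next
  case (Suc j)
  have v: "v \<in> bfs_ball E z i" "v \<notin> bfs_ball E z j"
    using assms(1) unfolding Suc bfs_layer_Suc by auto
  have u: "u \<in> bfs_ball E z (Suc i)" using v(1) assms(2) by auto
  have "u \<in> bfs_layer E z j" if "u \<in> bfs_ball E z j"
  proof (cases j)
    case 0
    then show ?thesis using that by simp
  next
    case (Suc h)
    have "u \<notin> bfs_ball E z h" using v(2) assms(2) unfolding Suc by (auto simp: insert_commute)
    then show ?thesis using that unfolding Suc bfs_layer_Suc by simp
  qed
  then show ?thesis using u unfolding Suc bfs_layer_Suc by blast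
qed

text \<open>Each step to a parent in the previous layer crosses the bipartition. Its use is to
  exclude edges inside a layer.\<close>

lemma bfs_layer_parity:
  assumes bip: "\<And>u v. {u, v} \<in> E \<Longrightarrow> (u \<in> A) \<noteq> (v \<in> A)"
  shows "u \<in> bfs_layer E z i \<Longrightarrow> (u \<in> A \<longleftrightarrow> (z \<in> A \<longleftrightarrow> even i))"
proof (induction i arbitrary: u)
  case (Suc i)
  then obtain v where "v \<in> bfs_layer E z i" "{u, v} \<in> E" using bfs_layer_parent by metis
  with Suc.IH[of v] bip[of u v] show ?case by auto
qed simp

text \<open>If all pairs of consecutive layers up to layer \<open>k\<close> spanned too few edges,
  each layer would be more than \<open>N\<close> times as large as the one before, and layer
  \<open>k\<close> would have more than \<open>N ^ k\<close> vertices.\<close>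

lemma dense_consecutive_layers:
  fixes c N :: real
  assumes G: "simple_graph V E" and z: "z \<in> V"
    and bip: "\<And>u v. {u, v} \<in> E \<Longrightarrow> (u \<in> A) \<noteq> (v \<in> A)"
    and deg: "\<And>v. v \<in> V \<Longrightarrow> 4 * c * N \<le> degree E v"
    and N: "N \<ge> 1" and k: "k \<ge> 1" and VN: "card V \<le> N ^ k" and c: "c > 0"
  obtains i where "i < k" "bfs_layer E z i \<noteq> {}"
    "c * card (bfs_layer E z i \<union> bfs_layer E z (Suc i))
      \<le> card {e \<in> E. e \<subseteq> bfs_layer E z i \<union> bfs_layer E z (Suc i)}"
proof (rule ccontr)
  let ?L = "bfs_layer E z"
  let ?E = "\<lambda>i. {e \<in> E. e \<subseteq> ?L i \<union> ?L (Suc i)}"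
  note found = that
  assume no_thesis: "\<not> thesis"
  have few: "card (?E i) < c * card (?L i \<union> ?L (Suc i))" if i: "i < k" "card (?L i) > 0" for i
  proof (rule ccontr)
    assume "\<not> ?thesis"
    moreover have "?L i \<noteq> {}" using i(2) by (metis card.empty less_irrefl)
    ultimately have thesis using i(1) by (intro found[of i]) auto
    then show False using no_thesis by contradiction
  qed
  have finE: "finite E" using simple_graph_finite_edges[OF G] .
  have finL: "finite (?L i)" for i
    using bfs_layer_subset[OF G z] G unfolding simple_graph_def by (auto intro: finite_subset)
  have card_layers: "card (?L i \<union> ?L (Suc i)) = card (?L i) + card (?L (Suc i))" for i
    using finL bfs_layer_disjoint[of _ E z i "Suc i"] by (subst card_Un_disjoint) auto
  have nbr: "u \<in> ?L (Suc i) \<or> (\<exists>j. i = Suc j \<and> u \<in> ?L j)"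
    if "v \<in> ?L i" "{v, u} \<in> E" for u v i
    using bfs_layer_neighbour[OF that] bfs_layer_parity[where u = u and i = i, OF bip]
      bfs_layer_parity[OF bip that(1)] bip[OF that(2)] by blast
  \<comment> \<open>By parity two vertices of one layer share no edge, so the degrees over the layer
    add up without double counting.\<close>
  have touch: "4 * c * N * card (?L i) \<le> card {e \<in> E. e \<inter> ?L i \<noteq> {}}" for i
  proof -
    have "{e \<in> E. e \<inter> ?L i \<noteq> {}} = (\<Union>v\<in>?L i. {e \<in> E. v \<in> e})" by auto
    moreover have "{e \<in> E. v \<in> e} \<inter> {e \<in> E. u \<in> e} = {}"
      if uv: "v \<in> ?L i" "u \<in> ?L i" "v \<noteq> u" for u v
    proof (rule ccontr)
      assume "\<not> ?thesis"
      then obtain e where e: "e \<in> E" "v \<in> e" "u \<in> e" by auto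
      then have "e = {v, u}" using simple_graph_edge[OF G e(1,2)] uv(3) by blast
      then show False
        using e(1) bip[of v u] bfs_layer_parity[OF bip uv(1)] bfs_layer_parity[OF bip uv(2)] by blast
    qed
    ultimately have "card {e \<in> E. e \<inter> ?L i \<noteq> {}} = (\<Sum>v\<in>?L i. degree E v)"
      unfolding degree_def using finL finE by (simp add: card_UN_disjoint)
    moreover have "(\<Sum>v\<in>?L i. 4 * c * N) \<le> (\<Sum>v\<in>?L i. real (degree E v))"
      using bfs_layer_subset[OF G z] deg by (intro sum_mono) auto
    ultimately show ?thesis by (simp add: mult.commute)
  qed
  have grow: "i < k \<Longrightarrow> card (?L i) > 0 \<and> N * card (?L i) < card (?L (Suc i))" for i
  proof (induction i)
    case 0
    have "{e \<in> E. e \<inter> ?L 0 \<noteq> {}} \<subseteq> ?E 0"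
    proof
      fix e assume "e \<in> {e \<in> E. e \<inter> ?L 0 \<noteq> {}}"
      then have e: "e \<in> E" "z \<in> e" by auto
      then obtain u where "e = {z, u}" using simple_graph_edge[OF G e] by metis
      then show "e \<in> ?E 0" using e nbr[of z 0 u] by auto
    qed
    then have "card {e \<in> E. e \<inter> ?L 0 \<noteq> {}} \<le> card (?E 0)" using finE by (intro card_mono) auto
    then have "4 * c * N < c * (1 + card (?L (Suc 0)))"
      using touch[of 0] few[of 0] 0 unfolding card_layers by simp
    then have "c * (4 * N) < c * (1 + card (?L (Suc 0)))" by (simp add: mult_ac)
    then have "4 * N < 1 + card (?L (Suc 0))" using c by simp
    then show ?case using N by simp
  next
    case (Suc i)
    have IH: "card (?L i) > 0" "N * card (?L i) < card (?L (Suc i))" using Suc by auto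
    have "0 \<le> N * card (?L i)" using N by simp
    then have pos: "card (?L (Suc i)) > 0" using IH by linarith
    have "{e \<in> E. e \<inter> ?L (Suc i) \<noteq> {}} \<subseteq> ?E i \<union> ?E (Suc i)"
    proof
      fix e assume "e \<in> {e \<in> E. e \<inter> ?L (Suc i) \<noteq> {}}"
      then obtain v where v: "e \<in> E" "v \<in> e" "v \<in> ?L (Suc i)" by auto
      then obtain u where "e = {v, u}" using simple_graph_edge[OF G v(1,2)] by metis
      then show "e \<in> ?E i \<union> ?E (Suc i)" using v nbr[of v "Suc i" u] by auto
    qed
    then have "card {e \<in> E. e \<inter> ?L (Suc i) \<noteq> {}} \<le> card (?E i \<union> ?E (Suc i))"
      using finE by (intro card_mono) auto
    also have "\<dots> \<le> card (?E i) + card (?E (Suc i))" by (rule card_Un_le)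
    finally have "4 * c * N * card (?L (Suc i))
        < c * (card (?L i) + 2 * card (?L (Suc i)) + card (?L (Suc (Suc i))))"
      using touch[of "Suc i"] few[of i] few[of "Suc i"] Suc.prems IH pos unfolding card_layers
      by (simp add: algebra_simps)
    then have "c * (4 * N * card (?L (Suc i)))
        < c * (card (?L i) + 2 * card (?L (Suc i)) + card (?L (Suc (Suc i))))"
      by (simp add: mult_ac)
    then have *: "4 * N * card (?L (Suc i)) < card (?L i) + 2 * card (?L (Suc i)) + card (?L (Suc (Suc i)))"
      using c by simp
    \<comment> \<open>The layer before and two copies of the current one use up at most three of the
      four multiples of \<open>N * card (?L (Suc i))\<close>; the fourth bounds the next layer from
      below.\<close>
    have "1 * real (card (?L i)) \<le> N * card (?L i)" using N by (intro mult_right_mono) auto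
    moreover have "1 * real (card (?L (Suc i))) \<le> N * card (?L (Suc i))"
      using N by (intro mult_right_mono) auto
    ultimately have "real (card (?L (Suc i))) > 0"
      "N * card (?L (Suc i)) < card (?L (Suc (Suc i)))"
      using * IH by linarith+
    then show ?case by simp
  qed
  \<comment> \<open>Strictness for \<open>i > 0\<close> is carried along because \<open>VN\<close>
    is only a weak inequality.\<close>
  have "N ^ i \<le> card (?L i) \<and> (i > 0 \<longrightarrow> N ^ i < card (?L i))" if "i \<le> k" for i
    using that
  proof (induction i)
    case (Suc i)
    have "N ^ Suc i \<le> N * card (?L i)" using Suc N by simp
    then show ?case using grow[of i] Suc.prems by auto
  qed simp
  then have "N ^ k < card (?L k)" using k by auto
  also have "card (?L k) \<le> card V"
    using bfs_layer_subset[OF G z] G by (intro card_mono) (auto simp: simple_graph_def)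
  finally show False using VN by simp
qed

subsection \<open>Rotations of a longest path\<close>

abbreviation adj :: "'a set set \<Rightarrow> 'a \<Rightarrow> 'a \<Rightarrow> bool" where
  "adj E u v \<equiv> {u, v} \<in> E"

lemma is_cycleI:
  assumes "length c \<ge> 3" "distinct c" "successively (adj E) c" "{last c, hd c} \<in> E"
  shows "is_cycle E c"
  unfolding is_cycle_def
proof (intro conjI allI impI)
  fix i assume i: "i < length c"
  show "{c ! i, c ! (Suc i mod length c)} \<in> E"
  proof (cases "Suc i = length c")
    case True
    then have "c ! i = last c" "c ! 0 = hd c" using assms(1)
      by (metis diff_Suc_1 last_conv_nth list.size(3) not_numeral_le_zero)
        (use assms(1) in \<open>cases c; auto\<close>)
    then show ?thesis using assms(4) True by simp
  next
    case False
    then have "Suc i < length c" using i by simp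
    then show ?thesis using assms(3) by (simp add: successively_conv_nth)
  qed
qed (use assms in auto)

fun path_edges :: "'a list \<Rightarrow> 'a set set" where
  "path_edges (x # y # zs) = insert {x, y} (path_edges (y # zs))"
| "path_edges _ = {}"

lemma path_edges_append:
  "xs \<noteq> [] \<Longrightarrow> ys \<noteq> [] \<Longrightarrow>
    path_edges (xs @ ys) = path_edges xs \<union> {{last xs, hd ys}} \<union> path_edges ys"
proof (induction xs rule: path_edges.induct)
  case ("2_2" v)
  then show ?case by (cases ys) auto
qed auto

lemma path_edges_Cons: "ys \<noteq> [] \<Longrightarrow> path_edges (x # ys) = insert {x, hd ys} (path_edges ys)"
  by (cases ys) auto

lemma path_edges_rev: "path_edges (rev xs) = path_edges xs"
proof (induction xs)
  case (Cons x xs)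
  then show ?case
    by (cases "xs = []") (auto simp: path_edges_append path_edges_Cons last_rev insert_commute)
qed simp

lemma path_edges_subset: "e \<in> path_edges xs \<Longrightarrow> e \<subseteq> set xs"
  by (induction xs rule: path_edges.induct) auto

lemma finite_path_neighbours: "finite {w. {z, w} \<in> path_edges P}"
  by (rule finite_subset[of _ "set P"]) (auto dest: path_edges_subset)

lemma card_path_neighbours:
  assumes "distinct P"
  shows "card {w. {z, w} \<in> path_edges P} \<le> 2"
proof (cases "z \<in> set P")
  case True
  then obtain as bs where P: "P = as @ z # bs" by (meson split_list)
  have "z \<notin> set as" "z \<notin> set bs" using assms P by auto
  then have "{w. {z, w} \<in> path_edges P} \<subseteq> {last as, hd bs}" unfolding P
    by (cases "as = []"; cases "bs = []")
      (auto simp: path_edges_append path_edges_Cons doubleton_eq_iff dest: path_edges_subset)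
  then have "card {w. {z, w} \<in> path_edges P} \<le> card {last as, hd bs}" by (intro card_mono) auto
  also have "\<dots> \<le> 2" by (simp add: card_insert_if)
  finally show ?thesis .
next
  case False
  then have "{w. {z, w} \<in> path_edges P} = {}" by (auto dest: path_edges_subset)
  then show ?thesis by simp
qed

text \<open>Posa's rotation with pivot \<open>y\<close>: the edge between \<open>y\<close> and
  \<open>hd ys\<close> is given up, the first vertex stays, and \<open>hd ys\<close> becomes the new
  last vertex.\<close>

inductive rotation :: "'a set set \<Rightarrow> 'a list \<Rightarrow> 'a list \<Rightarrow> bool" for E P where
  refl: "rotation E P P"
| step: "rotation E P (xs @ y # ys) \<Longrightarrow> ys \<noteq> [] \<Longrightarrow> {last ys, y} \<in> E \<Longrightarrow>
    rotation E P (xs @ y # rev ys)"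

lemma rotation_path:
  assumes "rotation E P Q" "distinct P" "successively (adj E) P"
  shows "distinct Q \<and> successively (adj E) Q \<and> set Q = set P \<and> length Q = length P"
  using assms
  by (induction rule: rotation.induct)
    (auto simp: successively_append_iff successively_Cons insert_commute hd_rev cong: successively_cong)

text \<open>Rotate a longest path. \<open>Z\<close> collects the last vertices reached; by
  maximality their neighbours all lie on the path, and each of them is in \<open>Z\<close> or next
  to \<open>Z\<close> on the original path, whence the factor 3 = 1 + 2. Closing a rotated path at
  the earliest neighbour of \<open>Z\<close> gives a cycle through \<open>Z\<close> and all its
  neighbours, and a third edge at its first vertex is a chord.\<close>

lemma posa_rotation:
  assumes G: "simple_graph V E" and V: "V \<noteq> {}" and deg: "\<And>v. v \<in> V \<Longrightarrow> degree E v \<ge> 3"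
  obtains c j Z where "is_cycle E c" "{c ! 0, c ! j} \<in> E" "2 \<le> j" "j + 2 \<le> length c"
    "Z \<subseteq> V" "Z \<noteq> {}"
    "card (Z \<union> {w. \<exists>z\<in>Z. {z, w} \<in> E}) \<le> 3 * card Z"
    "card (Z \<union> {w. \<exists>z\<in>Z. {z, w} \<in> E}) \<le> length c"
proof -
  let ?path = "\<lambda>P. P \<noteq> [] \<and> distinct P \<and> set P \<subseteq> V \<and> successively (adj E) P"
  have finV: "finite V" using G unfolding simple_graph_def by simp
  obtain v0 where v0: "v0 \<in> V" using V by auto
  have "?path [v0]" using v0 by simp
  moreover have "length P < Suc (card V)" if "?path P" for P
    using that finV card_mono[of V "set P"] distinct_card[of P] by simp
  ultimately obtain P where P: "?path P" and max: "\<And>Q. ?path Q \<Longrightarrow> length Q \<le> length P"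
    using ex_has_greatest_nat[of ?path "[v0]" length] by (metis less_Suc_eq_le)
  note inv = rotation_path[of E P]
  define Z where "Z = {last Q | Q. rotation E P Q}"
  define N where "N = {w. \<exists>z\<in>Z. {z, w} \<in> E}"
  have Q_path: "distinct Q" "successively (adj E) Q" "set Q = set P" "length Q = length P" "Q \<noteq> []"
    if "rotation E P Q" for Q
    using inv[OF that] P by auto
  have "Z \<subseteq> set P"
  proof
    fix u assume "u \<in> Z"
    then obtain Q where "rotation E P Q" "u = last Q" unfolding Z_def by blast
    then show "u \<in> set P" using Q_path[of Q] last_in_set[of Q] by simp
  qed
  have N_path: "w \<in> set P" if Q: "rotation E P Q" and w: "{last Q, w} \<in> E" for Q w
  proof (rule ccontr)
    assume "w \<notin> set P"
    moreover have "w \<in> V" using simple_graph_edge_vertices[OF G w] by simp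
    ultimately have "?path (Q @ [w])" using Q_path[OF Q] P w by (auto simp: successively_append_iff)
    then show False using max[of "Q @ [w]"] Q_path[OF Q] by simp
  qed
  have rotate: "\<exists>xs ys. Q = xs @ w # ys \<and> ys \<noteq> [] \<and> rotation E P (xs @ w # rev ys)"
    if Q: "rotation E P Q" and w: "{last Q, w} \<in> E" for Q w
  proof -
    have "w \<in> set Q" using N_path[OF Q w] Q_path[OF Q] by simp
    then obtain xs ys where xy: "Q = xs @ w # ys" by (meson split_list)
    have "w \<noteq> last Q" using simple_graph_edge_vertices[OF G w] by auto
    then have "ys \<noteq> []" using xy by auto
    moreover have "rotation E P (xs @ w # rev ys)"
      using Q w \<open>ys \<noteq> []\<close> unfolding xy by (intro rotation.step) auto
    ultimately show ?thesis using xy by blast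
  qed
  have N_sub: "N \<subseteq> Z \<union> (\<Union>z\<in>Z. {w. {z, w} \<in> path_edges P})"
  proof (rule subsetI, rule ccontr)
    fix w assume "w \<in> N" and w: "w \<notin> Z \<union> (\<Union>z\<in>Z. {w. {z, w} \<in> path_edges P})"
    then obtain Q where Q: "rotation E P Q" and wQ: "{last Q, w} \<in> E"
      unfolding N_def Z_def by blast
    \<comment> \<open>A rotation changes path edges only at \<open>y\<close>, \<open>hd ys\<close>
      and \<open>last ys\<close>. The latter two lie in \<open>Z\<close>, and \<open>w = y\<close>
      would make \<open>w\<close> a neighbour of \<open>hd ys\<close> on \<open>P\<close>. So the
      path edges at \<open>w\<close> survive every rotation.\<close>
    have same: "{e \<in> path_edges R. w \<in> e} = {e \<in> path_edges P. w \<in> e}" if "rotation E P R" for R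
      using that
    proof (induction rule: rotation.induct)
      case (step xs y ys)
      have rot: "rotation E P (xs @ y # rev ys)" using step.hyps by (rule rotation.step)
      have hd: "hd ys \<in> Z" unfolding Z_def
        using rot step.hyps(2) by (auto simp: last_rev intro!: exI[of _ "xs @ y # rev ys"])
      have la: "last ys \<in> Z" unfolding Z_def
        using step.hyps(1,2) by (auto intro!: exI[of _ "xs @ y # ys"])
      have "{y, hd ys} \<in> path_edges (xs @ y # ys)"
        using step.hyps(2) path_edges_append[of "xs @ [y]" ys] by simp
      then have "w \<noteq> y" using hd w step.IH by (auto simp: insert_commute)
      moreover have "w \<noteq> hd ys" "w \<noteq> last ys" using hd la w by auto
      moreover have "path_edges (xs @ y # ys) = path_edges (xs @ [y]) \<union> {{y, hd ys}} \<union> path_edges ys"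
        using step.hyps(2) path_edges_append[of "xs @ [y]" ys] by simp
      moreover have "path_edges (xs @ y # rev ys)
          = path_edges (xs @ [y]) \<union> {{y, last ys}} \<union> path_edges ys"
        using step.hyps(2) path_edges_append[of "xs @ [y]" "rev ys"] by (simp add: path_edges_rev hd_rev)
      ultimately show ?case using step.IH by auto
    qed simp
    \<comment> \<open>Rotating at \<open>w\<close> turns the successor of \<open>w\<close> on
      \<open>Q\<close> into a last vertex, and by \<open>same\<close> this successor is next to
      \<open>w\<close> on \<open>P\<close> already.\<close>
    obtain xs ys where xy: "Q = xs @ w # ys" "ys \<noteq> []" "rotation E P (xs @ w # rev ys)"
      using rotate[OF Q wQ] by blast
    have "hd ys \<in> Z" unfolding Z_def
      using xy by (auto simp: last_rev intro!: exI[of _ "xs @ w # rev ys"])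
    moreover have "{w, hd ys} \<in> path_edges Q"
      using xy(1,2) path_edges_append[of "xs @ [w]" ys] by simp
    then have "{hd ys, w} \<in> path_edges P" using same[OF Q] by (auto simp: insert_commute)
    ultimately show False using w by auto
  qed
  have finZ: "finite Z" using \<open>Z \<subseteq> set P\<close> finite_subset by blast
  have "card (Z \<union> N) \<le> card (Z \<union> (\<Union>z\<in>Z. {w. {z, w} \<in> path_edges P}))"
    using N_sub finZ finite_path_neighbours by (intro card_mono) auto
  also have "\<dots> \<le> card Z + card (\<Union>z\<in>Z. {w. {z, w} \<in> path_edges P})" by (rule card_Un_le)
  also have "card (\<Union>z\<in>Z. {w. {z, w} \<in> path_edges P}) \<le> (\<Sum>z\<in>Z. card {w. {z, w} \<in> path_edges P})"
    using finZ by (rule card_UN_le)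
  also have "\<dots> \<le> (\<Sum>z\<in>Z. 2)" using P card_path_neighbours by (intro sum_mono) auto
  finally have card3: "card (Z \<union> N) \<le> 3 * card Z" by simp
  have lastP: "last P \<in> Z" unfolding Z_def using rotation.refl by blast
  have "\<exists>w. {last P, w} \<in> E"
  proof -
    have "last P \<in> V" using P last_in_set by blast
    then have "degree E (last P) \<noteq> 0" using deg[of "last P"] by simp
    then have "{e \<in> E. last P \<in> e} \<noteq> {}" unfolding degree_def by (metis card.empty)
    then obtain e where "e \<in> E" "last P \<in> e" by auto
    then show ?thesis using simple_graph_edge[OF G] by metis
  qed
  then obtain w where w: "w \<in> N" "w \<in> set P" using lastP N_path rotation.refl unfolding N_def by blast
  then obtain i0 where i0: "i0 < length P \<and> P ! i0 \<in> N" by (metis in_set_conv_nth)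
  define a where "a = (LEAST i. i < length P \<and> P ! i \<in> N)"
  have a: "a < length P" "P ! a \<in> N" using LeastI[of "\<lambda>i. i < length P \<and> P ! i \<in> N", OF i0] unfolding a_def by auto
  have a_min: "a \<le> i" if "i < length P" "P ! i \<in> N" for i
    using that unfolding a_def by (intro Least_le) simp
  \<comment> \<open>Every pivot is adjacent to a last vertex, so it is in \<open>N\<close> and sits
    at position \<open>a\<close> or later; the positions 0 to \<open>a\<close> never change.\<close>
  have prefix: "take (Suc a) Q = take (Suc a) P" if "rotation E P Q" for Q
    using that
  proof (induction rule: rotation.induct)
    case (step xs y ys)
    have "y \<in> N" unfolding N_def Z_def
      using step.hyps by (auto intro!: exI[of _ "xs @ y # ys"] bexI[of _ "last ys"])
    have "a \<le> length xs"
    proof (rule ccontr)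
      assume "\<not> ?thesis"
      then have less: "length xs < a" by simp
      then have "P ! length xs = (xs @ y # ys) ! length xs"
        using step.IH by (metis less_SucI nth_take)
      then have "P ! length xs = y" by simp
      then show False using a_min[of "length xs"] less a(1) \<open>y \<in> N\<close> by simp
    qed
    then have "take (Suc a) (xs @ y # rev ys) = take (Suc a) (xs @ y # ys)"
      by (cases "a = length xs") auto
    then show ?case using step.IH by simp
  qed simp
  obtain Q where Q: "rotation E P Q" and wQ: "{last Q, P ! a} \<in> E"
    using a(2) unfolding N_def Z_def by blast
  define c where "c = rev (drop a Q)"
  have Qa: "Q ! a = P ! a" using prefix[OF Q] by (metis lessI nth_take)
  have lenQ: "length Q = length P" using Q_path[OF Q] by simp
  have c_ne: "drop a Q \<noteq> []" using a(1) lenQ by simp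
  have hd_c: "hd c = last Q" unfolding c_def using c_ne by (simp add: hd_rev last_drop)
  have last_c: "last c = P ! a" unfolding c_def using a(1) lenQ Qa by (simp add: last_rev hd_drop_conv_nth)
  \<comment> \<open>Before position \<open>a\<close> there is no vertex of \<open>N\<close> by
    minimality, and none of \<open>Z\<close>, since it would keep its position in all rotated paths
    and never be last.\<close>
  have ZN_c: "Z \<union> N \<subseteq> set c"
  proof (rule subsetI, rule ccontr)
    fix w assume w: "w \<in> Z \<union> N" and nc: "w \<notin> set c"
    have "w \<in> set P" using w \<open>Z \<subseteq> set P\<close> N_path unfolding N_def Z_def by blast
    then have "w \<in> set (take a Q @ drop a Q)" using Q_path[OF Q] by simp
    then have "w \<in> set (take a Q)" using nc unfolding c_def set_append by auto
    then obtain i where i: "i < a" "w = Q ! i" using a(1) lenQ by (auto simp: in_set_conv_nth)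
    then have iP: "w = P ! i" using prefix[OF Q] by (metis less_SucI nth_take)
    have "w \<notin> N" using a_min[of i] i(1) a(1) iP by auto
    then obtain R where R: "rotation E P R" "w = last R" using w unfolding Z_def by auto
    have "R ! i = P ! i" using prefix[OF R(1)] i(1) by (metis less_SucI nth_take)
    moreover have "last R = R ! (length P - 1)" using Q_path[OF R(1)] by (simp add: last_conv_nth)
    ultimately have "i = length P - 1"
      using R(2) iP i(1) a(1) Q_path[OF R(1)] nth_eq_iff_index_eq[of R i "length P - 1"] by auto
    then show False using i(1) a(1) by simp
  qed
  have dist_c: "distinct c" unfolding c_def using Q_path[OF Q] by simp
  have "successively (adj E) (take a Q @ drop a Q)" using Q_path[OF Q] by simp
  then have succ_c: "successively (adj E) c"
    unfolding c_def successively_append_iff by (simp add: insert_commute)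
  have c0: "c ! 0 = last Q" using hd_c c_ne unfolding c_def by (metis hd_conv_nth rev_is_Nil_conv)
  have zV: "last Q \<in> V" using Q_path[OF Q] P last_in_set by blast
  \<comment> \<open>All neighbours of \<open>c ! 0\<close> are on the cycle, only two of them next
    to it, and there are at least three.\<close>
  have "\<exists>j. {c ! 0, c ! j} \<in> E \<and> 2 \<le> j \<and> j + 2 \<le> length c"
  proof (rule ccontr)
    assume no: "\<not> ?thesis"
    have "{e \<in> E. last Q \<in> e} \<subseteq> {{last Q, c ! 1}, {last Q, c ! (length c - 1)}}"
    proof
      fix e assume "e \<in> {e \<in> E. last Q \<in> e}"
      then have e: "e \<in> E" "last Q \<in> e" by auto
      then obtain u where u: "e = {last Q, u}" "u \<noteq> last Q" using simple_graph_edge[OF G e] by metis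
      have "u \<in> N" using e(1) u Q unfolding N_def Z_def by blast
      then obtain j where j: "j < length c" "c ! j = u" using ZN_c by (metis UnCI in_set_conv_nth subsetD)
      have "j \<noteq> 0" using j u(2) c0 by metis
      moreover have "{c ! 0, c ! j} \<in> E" using e(1) u(1) j(2) c0 by metis
      then have "\<not> (2 \<le> j \<and> j + 2 \<le> length c)" using no by blast
      ultimately have "j = 1 \<or> j = length c - 1" using j(1) by linarith
      then show "e \<in> {{last Q, c ! 1}, {last Q, c ! (length c - 1)}}" using j u by auto
    qed
    then have "degree E (last Q) \<le> card {{last Q, c ! 1}, {last Q, c ! (length c - 1)}}"
      unfolding degree_def by (intro card_mono) auto
    also have "\<dots> \<le> 2" by (simp add: card_insert_if)
    finally show False using deg[OF zV] by simp
  qed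
  then obtain j where j: "{c ! 0, c ! j} \<in> E" "2 \<le> j" "j + 2 \<le> length c" by blast
  have "is_cycle E c"
    using j succ_c dist_c wQ hd_c last_c by (intro is_cycleI) (auto simp: insert_commute)
  moreover have "card (Z \<union> N) \<le> length c"
    using ZN_c by (metis card_mono distinct_card dist_c List.finite_set)
  moreover have "Z \<subseteq> V" using \<open>Z \<subseteq> set P\<close> P by blast
  ultimately show thesis using that[of c j Z] j card3 lastP unfolding N_def by blast
qed

subsection \<open>Paths in a cycle with a chord\<close>

lemma period_mult:
  fixes f :: "int \<Rightarrow> 'b" and d :: int
  assumes "\<And>x. f (x + d) = f x"
  shows "f (x + m * d) = f x"
proof (induction m rule: int_induct[where k = 0])
  case (step1 i)
  then show ?case using assms[of "x + i * d"] by (simp add: algebra_simps)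
next
  case (step2 i)
  then show ?case using assms[of "x + (i - 1) * d"] by (simp add: algebra_simps)
qed simp

text \<open>The remainder of any period modulo the least positive one is again a period, hence
  0.\<close>

lemma minimal_period:
  fixes f :: "int \<Rightarrow> 'b" and d :: int
  assumes d: "d > 0" "\<And>x. f (x + d) = f x"
  obtains p :: int where "p > 0" "\<And>x. f (x + p) = f x"
    "\<And>e. (\<And>x. f (x + e) = f x) \<Longrightarrow> p dvd e"
proof -
  let ?P = "\<lambda>n::nat. n > 0 \<and> (\<forall>x. f (x + int n) = f x)"
  have "?P (nat d)" using d by simp
  then obtain n where n: "?P n" and least: "\<And>m. m < n \<Longrightarrow> \<not> ?P m"
    using exists_least_iff[of ?P] by blast
  have "int n dvd e" if e: "\<And>x. f (x + e) = f x" for e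
  proof (rule ccontr)
    assume ndvd: "\<not> int n dvd e"
    have "f (x + e mod int n) = f x" for x
    proof -
      have "f (x + e mod int n) = f ((x + e mod int n) + (e div int n) * int n)"
        by (rule period_mult[symmetric]) (use n in auto)
      also have "(x + e mod int n) + (e div int n) * int n = x + e" by simp
      finally show ?thesis using e by simp
    qed
    moreover have "e mod int n \<noteq> 0" using ndvd mod_0_imp_dvd by blast
    then have "e mod int n > 0" "e mod int n < int n"
      using n pos_mod_sign[of "int n" e] pos_mod_bound[of "int n" e] by linarith+
    moreover from this have "nat (e mod int n) < n" by linarith
    ultimately show False using least[of "nat (e mod int n)"] by simp
  qed
  then show thesis using that[of "int n"] n by auto
qed

lemma periodic_eq_on_window:
  fixes f g :: "int \<Rightarrow> 'b" and p :: int
  assumes "p > 0" "\<And>x. f (x + p) = f x" "\<And>x. g (x + p) = g x"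
    and eq: "\<And>x. a \<le> x \<Longrightarrow> x < a + p \<Longrightarrow> f x = g x"
  shows "f x = g x"
proof -
  have x: "x = (a + (x - a) mod p) + ((x - a) div p) * p" by simp
  have "f (a + (x - a) mod p) = g (a + (x - a) mod p)"
    using assms(1) by (intro eq) auto
  then show ?thesis using x period_mult[of f p, OF assms(2)] period_mult[of g p, OF assms(3)] by metis
qed

text \<open>The index of a vertex on a cycle of length \<open>L\<close> with chord between \<open>0\<close> and \<open>j\<close>
  runs over the integers modulo \<open>L\<close>; the hypotheses say that the two ends of each path of length
  \<open>l\<close>, along the cycle or through the chord, have the same colour. The two families of paths that
  run along both arcs are reflections of the cycle whose composition is the shift by 2.\<close>

lemma chord_colouring_period_2:
  fixes \<chi> :: "int \<Rightarrow> bool" and L l j :: int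
  assumes L: "\<And>x. \<chi> (x + L) = \<chi> x" and l: "\<And>x. \<chi> (x + l) = \<chi> x"
    and bounds: "0 < l" "l < L" "2 \<le> j" "j \<le> L - 2"
    and down: "\<And>s. 0 \<le> s \<Longrightarrow> s \<le> L - j - 1 \<Longrightarrow> s \<le> l - 1 \<Longrightarrow> l - s \<le> j \<Longrightarrow> \<chi> (- s) = \<chi> (j - (l - 1 - s))"
    and up: "\<And>s. 0 \<le> s \<Longrightarrow> s \<le> j - 1 \<Longrightarrow> s \<le> l - 1 \<Longrightarrow> l - s \<le> L - j \<Longrightarrow> \<chi> s = \<chi> (j + (l - 1 - s))"
    and out: "\<And>s. 0 \<le> s \<Longrightarrow> s \<le> l - 1 \<Longrightarrow> l \<le> L - j \<Longrightarrow> \<chi> (- s) = \<chi> (j + (l - 1 - s))"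
    and inside: "\<And>s. 0 \<le> s \<Longrightarrow> s \<le> l - 1 \<Longrightarrow> l \<le> j \<Longrightarrow> \<chi> s = \<chi> (j - (l - 1 - s))"
  shows "\<chi> (x + 2) = \<chi> x"
proof -
  obtain p where p: "p > 0" "\<And>x. \<chi> (x + p) = \<chi> x" "\<And>e. (\<And>x. \<chi> (x + e) = \<chi> x) \<Longrightarrow> p dvd e"
    using minimal_period[of l \<chi>] bounds l by blast
  have p': "\<chi> (x - p) = \<chi> x" for x using p(2)[of "x - p"] by simp
  have l': "\<chi> (x - l) = \<chi> x" for x using l[of "x - l"] by simp
  have pl: "p dvd l" and pL: "p dvd L" using p(3) l L by auto
  have "p \<le> l" using pl bounds by (simp add: zdvd_imp_le)
  have "p \<le> L - l" using pl pL bounds by (simp add: zdvd_imp_le)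
  \<comment> \<open>\<open>out\<close> at \<open>s = - x\<close>, combined with the period
    \<open>l\<close>, is a shift by \<open>j - 1\<close> on \<open>p\<close> consecutive arguments,
    so \<open>p\<close> divides \<open>j - 1\<close>. In the same way \<open>inside\<close> gives
    the divisor \<open>j + 1\<close> below. These bounds on \<open>p\<close> make room for the
    windows of the two reflections.\<close>
  have pj: "p \<le> j - 1" if lj: "l \<le> L - j"
  proof -
    have "\<chi> (x + (j - 1)) = \<chi> x" for x
    proof -
      have "(\<lambda>x. \<chi> (x + (j - 1))) x = \<chi> x"
      proof (rule periodic_eq_on_window[where p = p and a = "- (p - 1)"])
        show "\<chi> (x + p + (j - 1)) = \<chi> (x + (j - 1))" for x
          using p(2)[of "x + (j - 1)"] by (simp add: algebra_simps)
        fix x assume "- (p - 1) \<le> x" "x < - (p - 1) + p"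
        then have "\<chi> x = \<chi> (j + (l - 1 + x))" using out[of "- x"] lj \<open>p \<le> l\<close> by simp
        then show "\<chi> (x + (j - 1)) = \<chi> x" using l[of "x + (j - 1)"] by (simp add: algebra_simps)
      qed (use p in auto)
      then show ?thesis .
    qed
    then have "p dvd j - 1" using p(3) by blast
    then show ?thesis using bounds zdvd_imp_le[of p "j - 1"] by simp
  qed
  have pLj: "p \<le> L - j - 1" if lj: "l \<le> j"
  proof -
    have "\<chi> (x + (j + 1)) = \<chi> x" for x
    proof -
      have "(\<lambda>x. \<chi> (x + (j + 1))) x = \<chi> x"
      proof (rule periodic_eq_on_window[where p = p and a = 0])
        show "\<chi> (x + p + (j + 1)) = \<chi> (x + (j + 1))" for x
          using p(2)[of "x + (j + 1)"] by (simp add: algebra_simps)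
        fix x assume "0 \<le> x" "x < 0 + p"
        then have "\<chi> x = \<chi> (j - (l - 1 - x))" using inside[of x] lj \<open>p \<le> l\<close> by simp
        then show "\<chi> (x + (j + 1)) = \<chi> x" using l'[of "x + (j + 1)"] by (simp add: algebra_simps)
      qed (use p in auto)
      then show ?thesis .
    qed
    then have "p dvd j + 1" using p(3) by blast
    then have "p dvd L - (j + 1)" using pL by (rule dvd_diff[rotated])
    then show ?thesis using bounds zdvd_imp_le[of p "L - (j + 1)"] by simp
  qed
  \<comment> \<open>\<open>up\<close> is available only for an interval of \<open>s\<close>, but the
    bounds on \<open>p\<close> show that this interval contains \<open>p\<close> consecutive values
    from its lower end on, which is enough by periodicity.\<close>
  have reflect_up: "\<chi> x = \<chi> (j - 1 - x)" for x
  proof (rule periodic_eq_on_window[where p = p and a = "max 0 (l - (L - j))" and g = "\<lambda>x. \<chi> (j - 1 - x)"])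
    show "\<chi> (j - 1 - (x + p)) = \<chi> (j - 1 - x)" for x
      using p'[of "j - 1 - x"] by (simp add: algebra_simps)
    fix x assume x: "max 0 (l - (L - j)) \<le> x" "x < max 0 (l - (L - j)) + p"
    have "x \<le> j - 1 \<and> x \<le> l - 1"
      using x pj pLj \<open>p \<le> l\<close> \<open>p \<le> L - l\<close> by (cases "l \<le> j"; cases "l \<le> L - j") auto
    then have "\<chi> x = \<chi> (j + (l - 1 - x))" using x by (intro up) auto
    then show "\<chi> x = \<chi> (j - 1 - x)" using l[of "j - 1 - x"] by (simp add: algebra_simps)
  qed (use p in auto)
  have reflect_down: "\<chi> (- x) = \<chi> (j + 1 + x)" for x
  proof (rule periodic_eq_on_window[where p = p and a = "max 0 (l - j)" and f = "\<lambda>x. \<chi> (- x)"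
        and g = "\<lambda>x. \<chi> (j + 1 + x)"])
    show "\<chi> (- (x + p)) = \<chi> (- x)" for x using p'[of "- x"] by (simp only: minus_add_distrib diff_conv_add_uminus)
    show "\<chi> (j + 1 + (x + p)) = \<chi> (j + 1 + x)" for x
      using p(2)[of "j + 1 + x"] by (simp add: algebra_simps)
    fix x assume x: "max 0 (l - j) \<le> x" "x < max 0 (l - j) + p"
    have "x \<le> L - j - 1 \<and> x \<le> l - 1"
      using x pj pLj \<open>p \<le> l\<close> \<open>p \<le> L - l\<close> by (cases "l \<le> j"; cases "l \<le> L - j") auto
    then have "\<chi> (- x) = \<chi> (j - (l - 1 - x))" using x by (intro down) auto
    then show "\<chi> (- x) = \<chi> (j + 1 + x)" using l'[of "j + 1 + x"] by (simp add: algebra_simps)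
  qed (use p in auto)
  show ?thesis using reflect_up[of "j - 1 - x - 2"] reflect_up[of "j - 1 - x"]
      reflect_down[of "x - (j - 1)"] reflect_down[of "x + 2 - (j + 1)"]
    by (simp add: algebra_simps)
qed

lemma successively_upto:
  assumes "\<And>x. a \<le> x \<Longrightarrow> x < b \<Longrightarrow> P x (x + 1)"
  shows "successively P [a..b]"
  unfolding successively_conv_nth
proof (intro allI impI)
  fix i assume "Suc i < length [a..b]"
  then have "[a..b] ! i = a + int i" "[a..b] ! Suc i = (a + int i) + 1" "a + int i < b"
    by (simp_all add: nth_upto)
  then show "P ([a..b] ! i) ([a..b] ! Suc i)" using assms[of "a + int i"] by (simp only:)
qed

text \<open>Here \<open>v\<close> parametrises the cycle by the integers. The paths are an arc of
  \<open>l\<close> edges, or \<open>s\<close> steps to 0, the chord and \<open>l - 1 - s\<close>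
  steps away from \<open>j\<close> in either direction; the bounds keep the two arcs disjoint. The
  mirror images of the chord paths come from the reversed cycle.\<close>

lemma chord_path_colours:
  fixes v :: "int \<Rightarrow> 'a" and L l j :: int
  assumes adj: "\<And>x. {v x, v (x + 1)} \<in> E"
    and inj: "\<And>x y. v x = v y \<Longrightarrow> \<bar>x - y\<bar> < L \<Longrightarrow> x = y"
    and chord: "{v 0, v j} \<in> E" and bounds: "0 < l" "l < L" "2 \<le> j" "j \<le> L - 2"
    and same: "\<And>xs. distinct xs \<Longrightarrow> successively (adj E) xs \<Longrightarrow> set xs \<subseteq> range v \<Longrightarrow>
      int (length xs) = l + 1 \<Longrightarrow> hd xs \<in> A \<longleftrightarrow> last xs \<in> A"
  shows "v (x + l) \<in> A \<longleftrightarrow> v x \<in> A"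
    and "0 \<le> s \<Longrightarrow> s \<le> L - j - 1 \<Longrightarrow> s \<le> l - 1 \<Longrightarrow> l - s \<le> j \<Longrightarrow>
      v (- s) \<in> A \<longleftrightarrow> v (j - (l - 1 - s)) \<in> A"
    and "0 \<le> s \<Longrightarrow> s \<le> l - 1 \<Longrightarrow> l \<le> L - j \<Longrightarrow> v (- s) \<in> A \<longleftrightarrow> v (j + (l - 1 - s)) \<in> A"
proof -
  have arc: "distinct (map v [a..b])" "successively (adj E) (map v [a..b])" if "b - a < L" for a b
  proof -
    show "distinct (map v [a..b])" unfolding distinct_map
      using that by (auto intro!: inj_onI inj)
    show "successively (adj E) (map v [a..b])"
      unfolding successively_map by (rule successively_upto) (rule adj)
  qed
  have ends: "hd (map v [a..b]) = v a" "last (map v [a..b]) = v b" "map v [a..b] \<noteq> []" if "a \<le> b" for a b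
  proof -
    show "hd (map v [a..b]) = v a" "map v [a..b] \<noteq> []" using upto_rec1[OF that] by simp_all
    show "last (map v [a..b]) = v b" using upto_rec2[OF that] by simp
  qed
  have disj: "set (map v [a..b]) \<inter> set (map v [a'..b']) = {}" if "b < a'" "b' - a < L" for a b a' b'
  proof (rule ccontr)
    assume "\<not> ?thesis"
    then obtain w where "w \<in> v ` {a..b}" "w \<in> v ` {a'..b'}" by auto
    then obtain x y where xy: "x \<in> {a..b}" "y \<in> {a'..b'}" "v x = v y" by (metis imageE)
    moreover have "\<bar>x - y\<bar> < L" using xy that by auto
    ultimately have "x = y" using inj by blast
    then show False using xy that by simp
  qed
  have "hd (map v [x..x + l]) \<in> A \<longleftrightarrow> last (map v [x..x + l]) \<in> A"
    using bounds arc[of "x + l" x] by (intro same) auto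
  then show "v (x + l) \<in> A \<longleftrightarrow> v x \<in> A" using bounds ends[of x "x + l"] by auto
  show "v (- s) \<in> A \<longleftrightarrow> v (j - (l - 1 - s)) \<in> A"
    if s: "0 \<le> s" "s \<le> L - j - 1" "s \<le> l - 1" "l - s \<le> j"
  proof -
    let ?a = "map v [-s..0]" and ?b = "map v [j - (l - 1 - s)..j]"
    have "hd (?a @ rev ?b) \<in> A \<longleftrightarrow> last (?a @ rev ?b) \<in> A"
    proof (rule same)
      show "distinct (?a @ rev ?b)"
        using s bounds arc[of 0 "-s"] arc[of j "j - (l - 1 - s)"] disj[of 0 "j - (l - 1 - s)" j "-s"]
        by (simp del: distinct_map set_map)
      show "successively (adj E) (?a @ rev ?b)"
        using s bounds arc[of 0 "-s"] arc[of j "j - (l - 1 - s)"] ends[of "-s" 0]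
          ends[of "j - (l - 1 - s)" j] chord
        by (simp add: successively_append_iff insert_commute hd_rev del: hd_map last_map map_is_Nil_conv)
    qed (use s in auto)
    then show ?thesis using s ends[of "-s" 0] ends[of "j - (l - 1 - s)" j]
      by (simp add: last_rev hd_append last_append del: map_is_Nil_conv)
  qed
  show "v (- s) \<in> A \<longleftrightarrow> v (j + (l - 1 - s)) \<in> A" if s: "0 \<le> s" "s \<le> l - 1" "l \<le> L - j"
  proof -
    let ?a = "map v [-s..0]" and ?b = "map v [j..j + (l - 1 - s)]"
    have "hd (?a @ ?b) \<in> A \<longleftrightarrow> last (?a @ ?b) \<in> A"
    proof (rule same)
      show "distinct (?a @ ?b)"
        using s bounds arc[of 0 "-s"] arc[of "j + (l - 1 - s)" j] disj[of 0 j "j + (l - 1 - s)" "-s"]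
        by (simp del: distinct_map set_map)
      show "successively (adj E) (?a @ ?b)"
        using s bounds arc[of 0 "-s"] arc[of "j + (l - 1 - s)" j] ends[of "-s" 0]
          ends[of j "j + (l - 1 - s)"] chord
        by (simp add: successively_append_iff del: hd_map last_map map_is_Nil_conv)
    qed (use s in auto)
    then show ?thesis using s ends[of "-s" 0] ends[of j "j + (l - 1 - s)"]
      by (simp add: hd_append last_append del: map_is_Nil_conv)
  qed
qed

text \<open>If no path with \<open>l\<close> edges leads from \<open>A\<close> out of
  \<open>A\<close>, the colouring of the cycle by membership in \<open>A\<close> meets the
  hypotheses of \<open>chord_colouring_period_2\<close>. The contrapositive produces paths.\<close>

lemma cycle_with_chord_path:
  assumes cyc: "is_cycle E c" and chord: "{c ! 0, c ! j} \<in> E" "2 \<le> j" "j + 2 \<le> length c"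
    and l: "0 < l" "l < length c"
    and no_path: "\<And>xs. distinct xs \<Longrightarrow> successively (adj E) xs \<Longrightarrow> set xs \<subseteq> set c \<Longrightarrow>
      length xs = l + 1 \<Longrightarrow> hd xs \<in> A \<Longrightarrow> last xs \<in> A"
    and pq: "p < length c" "q < length c" "even p \<longleftrightarrow> even q"
  shows "c ! p \<in> A \<longleftrightarrow> c ! q \<in> A"
proof -
  let ?L = "int (length c)"
  define v where "v x = c ! nat (x mod ?L)" for x :: int
  have Lpos: "?L > 0" using l by linarith
  have dist: "distinct c" using cyc unfolding is_cycle_def by simp
  have v_nth: "v (int i) = c ! i" if "i < length c" for i
    using that unfolding v_def by simp
  have v_per: "v (x + ?L) = v x" for x unfolding v_def by simp
  have v_range: "range v \<subseteq> set c" unfolding v_def using Lpos by (auto simp: nat_less_iff)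
  have v_adj: "{v x, v (x + 1)} \<in> E" for x
  proof -
    have lt: "nat (x mod ?L) < length c" using Lpos by (simp add: nat_less_iff)
    have "(x + 1) mod ?L = int (Suc (nat (x mod ?L)) mod length c)"
      using Lpos by (simp add: zmod_int mod_simps add.commute)
    then have "v (x + 1) = c ! (Suc (nat (x mod ?L)) mod length c)" unfolding v_def by simp
    then show ?thesis using cyc lt unfolding is_cycle_def v_def by simp
  qed
  have v_inj: "x = y" if "v x = v y" "\<bar>x - y\<bar> < ?L" for x y
  proof -
    have "nat (x mod ?L) = nat (y mod ?L)" using that(1) dist Lpos unfolding v_def
      by (subst (asm) nth_eq_iff_index_eq) (auto simp: nat_less_iff)
    then have "x mod ?L = y mod ?L" using Lpos by (metis nat_0_le pos_mod_sign)
    then have "?L dvd x - y" by (simp add: mod_eq_dvd_iff)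
    then show ?thesis using that(2) dvd_imp_le_int[of "x - y" ?L] by auto
  qed
  \<comment> \<open>Reversing paths turns the one-sided \<open>no_path\<close> into an
    equivalence.\<close>
  have same: "hd xs \<in> A \<longleftrightarrow> last xs \<in> A"
    if xs: "distinct xs" "successively (adj E) xs" "set xs \<subseteq> range v" "int (length xs) = int l + 1" for xs
  proof -
    have len: "length xs = l + 1" and sub: "set xs \<subseteq> set c" using xs v_range by auto
    show ?thesis using no_path[OF xs(1,2) sub len] no_path[of "rev xs"] xs sub len
      by (auto simp: hd_rev last_rev insert_commute)
  qed
  have v0: "v 0 = c ! 0" and vj: "v (int j) = c ! j" using v_nth[of 0] v_nth[of j] chord Lpos
    by (simp_all add: v_def)
  have jb: "2 \<le> int j" "int j \<le> ?L - 2" "0 < int l" "int l < ?L" using chord l by auto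
  \<comment> \<open>Backwards traversal puts the chord between 0 and \<open>?L - int j\<close> and
    supplies the families \<open>up\<close> and \<open>inside\<close>.\<close>
  define w where "w x = v (- x)" for x
  have w_range: "range w = range v" unfolding w_def by (auto simp: image_iff) (metis minus_minus)
  have w_adj: "{w x, w (x + 1)} \<in> E" for x
    using v_adj[of "- x - 1"] unfolding w_def by (simp add: insert_commute)
  have w_inj: "x = y" if "w x = w y" "\<bar>x - y\<bar> < ?L" for x y
    using v_inj[of "- x" "- y"] that unfolding w_def by simp
  have wj: "w (?L - int j) = c ! j" using v_per[of "int j - ?L"] vj unfolding w_def by simp
  have w_chord: "{w 0, w (?L - int j)} \<in> E" using v0 wj chord unfolding w_def by simp
  have v_chord: "{v 0, v (int j)} \<in> E" using v0 vj chord by simp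
  have same_w: "hd xs \<in> A \<longleftrightarrow> last xs \<in> A"
    if "distinct xs" "successively (adj E) xs" "set xs \<subseteq> range w" "int (length xs) = int l + 1" for xs
    using same that unfolding w_range by blast
  have jb': "2 \<le> ?L - int j" "?L - int j \<le> ?L - 2" using jb by auto
  have v_paths: "v (x + int l) \<in> A \<longleftrightarrow> v x \<in> A"
    "0 \<le> s \<Longrightarrow> s \<le> ?L - int j - 1 \<Longrightarrow> s \<le> int l - 1 \<Longrightarrow> int l - s \<le> int j \<Longrightarrow>
      v (- s) \<in> A \<longleftrightarrow> v (int j - (int l - 1 - s)) \<in> A"
    "0 \<le> s \<Longrightarrow> s \<le> int l - 1 \<Longrightarrow> int l \<le> ?L - int j \<Longrightarrow>
      v (- s) \<in> A \<longleftrightarrow> v (int j + (int l - 1 - s)) \<in> A" for x s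
    by (rule chord_path_colours[of v E ?L "int j" "int l" A, OF v_adj _ v_chord jb(3,4,1,2)];
        (assumption | erule (1) v_inj | erule (3) same))+
  have w_paths:
    "0 \<le> s \<Longrightarrow> s \<le> ?L - (?L - int j) - 1 \<Longrightarrow> s \<le> int l - 1 \<Longrightarrow> int l - s \<le> ?L - int j \<Longrightarrow>
      w (- s) \<in> A \<longleftrightarrow> w ((?L - int j) - (int l - 1 - s)) \<in> A"
    "0 \<le> s \<Longrightarrow> s \<le> int l - 1 \<Longrightarrow> int l \<le> ?L - (?L - int j) \<Longrightarrow>
      w (- s) \<in> A \<longleftrightarrow> w ((?L - int j) + (int l - 1 - s)) \<in> A" for s
    by (rule chord_path_colours[of w E ?L "?L - int j" "int l" A, OF w_adj _ w_chord jb(3,4) jb'];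
        (assumption | erule (1) w_inj | erule (3) same_w))+
  have per2: "v (x + 2) \<in> A \<longleftrightarrow> v x \<in> A" for x
  proof (rule chord_colouring_period_2[of "\<lambda>x. v x \<in> A" ?L "int l" "int j"])
    show "v s \<in> A \<longleftrightarrow> v (int j + (int l - 1 - s)) \<in> A"
      if "0 \<le> s" "s \<le> int j - 1" "s \<le> int l - 1" "int l - s \<le> ?L - int j" for s
      using w_paths(1)[of s] that jb v_per[of "int j + (int l - 1 - s) - ?L"]
      unfolding w_def by (simp add: algebra_simps)
    show "v s \<in> A \<longleftrightarrow> v (int j - (int l - 1 - s)) \<in> A"
      if "0 \<le> s" "s \<le> int l - 1" "int l \<le> int j" for s
      using w_paths(2)[of s] that jb v_per[of "int j - (int l - 1 - s) - ?L"]
      unfolding w_def by (simp add: algebra_simps)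
    show "v (x + ?L) \<in> A \<longleftrightarrow> v x \<in> A" for x using v_per by simp
  qed (rule v_paths jb; assumption?)+
  have "even (int q - int p)" using pq(3) by simp
  then obtain t where "int q - int p = 2 * t" by (elim evenE)
  then have "int q = int p + t * 2" by simp
  then have "v (int q) \<in> A \<longleftrightarrow> v (int p) \<in> A"
    using period_mult[of "\<lambda>x. v x \<in> A" 2 "int p" t] per2 by simp
  then show ?thesis using v_nth pq by simp
qed

section \<open>Cycles closed through the search tree\<close>

text \<open>Fix one parent per vertex. If \<open>X\<close> has a single parent, \<open>m = 1\<close>
  and one vertex serves as \<open>A\<close>; otherwise apply induction to the set of parents, pull
  \<open>A\<close> back and lengthen the paths by an edge at both ends. So \<open>A\<close> is the
  part of \<open>X\<close> below one child of the last common ancestor, which is \<open>m\<close>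
  layers away.\<close>

lemma bfs_tree_paths:
  assumes "X \<subseteq> bfs_layer E z i" "x1 \<in> X" "x2 \<in> X" "x1 \<noteq> x2"
  shows "\<exists>m A. 1 \<le> m \<and> m \<le> i \<and> A \<subseteq> X \<and> A \<noteq> {} \<and> A \<noteq> X \<and>
    (\<forall>x\<in>A. \<forall>y\<in>X - A. \<exists>ps. length ps = 2 * m - 1 \<and> distinct ps \<and>
      successively (adj E) (x # ps @ [y]) \<and> set ps \<subseteq> (\<Union>j<i. bfs_layer E z j))"
  using assms
proof (induction i arbitrary: X x1 x2)
  case 0
  then show ?case by auto
next
  case (Suc i)
  obtain f where f: "\<And>u. u \<in> bfs_layer E z (Suc i) \<Longrightarrow> f u \<in> bfs_layer E z i \<and> {u, f u} \<in> E"
    using bfs_layer_parent[of _ E z i] by metis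
  have fX: "f x \<in> bfs_layer E z i" "{x, f x} \<in> E" "{f x, x} \<in> E" if "x \<in> X" for x
    using f[of x] that Suc.prems(1) by (auto simp: insert_commute)
  show ?case
  proof (cases "\<exists>y1\<in>X. \<exists>y2\<in>X. f y1 \<noteq> f y2")
    case True
    then obtain y1 y2 where "f y1 \<in> f ` X" "f y2 \<in> f ` X" "f y1 \<noteq> f y2" by blast
    from Suc.IH[OF _ this] fX obtain m A where m: "1 \<le> m" "m \<le> i"
      and A: "A \<subseteq> f ` X" "A \<noteq> {}" "A \<noteq> f ` X"
      and ps: "\<And>x y. x \<in> A \<Longrightarrow> y \<in> f ` X - A \<Longrightarrow> \<exists>ps. length ps = 2 * m - 1 \<and> distinct ps \<and>
        successively (adj E) (x # ps @ [y]) \<and> set ps \<subseteq> (\<Union>j<i. bfs_layer E z j)"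
      by (metis (no_types, lifting) image_subsetI)
    let ?A = "{x \<in> X. f x \<in> A}"
    have "\<exists>ps. length ps = 2 * Suc m - 1 \<and> distinct ps \<and>
        successively (adj E) (x # ps @ [y]) \<and> set ps \<subseteq> (\<Union>j<Suc i. bfs_layer E z j)"
      if x: "x \<in> ?A" and y: "y \<in> X - ?A" for x y
    proof -
      obtain qs where qs: "length qs = 2 * m - 1" "distinct qs"
        "successively (adj E) (f x # qs @ [f y])" "set qs \<subseteq> (\<Union>j<i. bfs_layer E z j)"
        using ps[of "f x" "f y"] x y by blast
      have "f x \<notin> set qs" "f y \<notin> set qs"
        using qs(4) fX(1)[of x] fX(1)[of y] x y bfs_layer_disjoint[of _ E z i] by blast+
      then have "distinct (f x # qs @ [f y])" using qs(2) x y by auto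
      moreover have "successively (adj E) ((x # f x # qs @ [f y]) @ [y])"
        unfolding successively_append_iff using qs(3) fX x y by auto
      moreover have "set (f x # qs @ [f y]) \<subseteq> (\<Union>j<Suc i. bfs_layer E z j)"
        using qs(4) fX(1)[of x] fX(1)[of y] x y unfolding lessThan_Suc by auto
      moreover have "length (f x # qs @ [f y]) = 2 * Suc m - 1" using qs(1) m by simp
      ultimately show ?thesis by (intro exI[of _ "f x # qs @ [f y]"]) simp
    qed
    moreover have "?A \<noteq> {}" "?A \<noteq> X" using A by auto
    ultimately show ?thesis using m by (intro exI[of _ "Suc m"] exI[of _ ?A]) auto
  next
    case False
    have "\<exists>ps. length ps = 2 * 1 - 1 \<and> distinct ps \<and>
        successively (adj E) (x1 # ps @ [y]) \<and> set ps \<subseteq> (\<Union>j<Suc i. bfs_layer E z j)" if "y \<in> X" for y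
    proof -
      have "f y = f x1" using False that Suc.prems by blast
      then show ?thesis using fX[of x1] fX[of y] that Suc.prems by (intro exI[of _ "[f x1]"]) auto
    qed
    then show ?thesis using Suc.prems by (intro exI[of _ 1] exI[of _ "{x1}"]) auto
  qed
qed

lemma cycle_alternates:
  assumes cyc: "is_cycle F c" and bip: "\<And>u v. {u, v} \<in> F \<Longrightarrow> u \<in> X \<longleftrightarrow> v \<notin> X"
  shows "p < length c \<Longrightarrow> c ! p \<in> X \<longleftrightarrow> (c ! 0 \<in> X \<longleftrightarrow> even p)"
proof (induction p)
  case (Suc p)
  then have "{c ! p, c ! Suc p} \<in> F" using cyc unfolding is_cycle_def by (metis Suc_lessD mod_less)
  then show ?case using bip Suc by auto
qed simp

lemma path_alternates:
  assumes bip: "\<And>u v. {u, v} \<in> F \<Longrightarrow> u \<in> X \<longleftrightarrow> v \<notin> X"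
  shows "successively (adj F) xs \<Longrightarrow> xs \<noteq> [] \<Longrightarrow> last xs \<in> X \<longleftrightarrow> (hd xs \<in> X \<longleftrightarrow> odd (length xs))"
proof (induction xs rule: induct_list012)
  case (3 x y zs)
  then show ?case using bip[of x y] by auto
qed auto

text \<open>The vertices of \<open>c\<close> in layer \<open>i\<close> are those at positions of one
  parity, so a set \<open>A\<close> that splits them contradicts the conclusion of
  \<open>cycle_with_chord_path\<close>. Hence for each \<open>l\<close> some path of
  \<open>l\<close> edges leads out of \<open>A\<close>, and the tree closes it with
  \<open>2 * m\<close> edges, where \<open>m\<close> does not depend on \<open>l\<close>.\<close>

lemma cycles_through_bfs_tree:
  assumes FE: "F \<subseteq> E"
    and layers: "\<And>u v. {u, v} \<in> F \<Longrightarrow> u \<in> bfs_layer E z i \<and> v \<in> bfs_layer E z (Suc i) \<or>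
      v \<in> bfs_layer E z i \<and> u \<in> bfs_layer E z (Suc i)"
    and cyc: "is_cycle F c" and chord: "{c ! 0, c ! j} \<in> F" "2 \<le> j" "j + 2 \<le> length c"
  obtains m where "1 \<le> m" "m \<le> i"
    "\<And>l. even l \<Longrightarrow> 0 < l \<Longrightarrow> l < length c \<Longrightarrow> has_cycle_of_length E (2 * m + l)"
proof -
  let ?L = "bfs_layer E z"
  define X where "X = set c \<inter> ?L i"
  have bip: "u \<in> ?L i \<longleftrightarrow> v \<notin> ?L i" if "{u, v} \<in> F" for u v
    using layers[OF that] bfs_layer_disjoint[of _ E z i "Suc i"] by auto
  have alt: "c ! p \<in> ?L i \<longleftrightarrow> (c ! 0 \<in> ?L i \<longleftrightarrow> even p)" if "p < length c" for p
    using cycle_alternates[OF cyc bip that] .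
  have dist: "distinct c" using cyc unfolding is_cycle_def by simp
  have len: "4 \<le> length c" "c \<noteq> []" using chord by auto
  \<comment> \<open>The first position in layer \<open>i\<close>; by alternation position
    \<open>b + 2\<close> is in that layer too.\<close>
  define b where "b = (if c ! 0 \<in> ?L i then 0 else 1::nat)"
  have "c ! b \<in> X" "c ! (b + 2) \<in> X" unfolding X_def using alt[of b] alt[of "b + 2"] len
      nth_mem[of b c] nth_mem[of "b + 2" c] unfolding b_def
    by (auto split: if_splits simp del: nth_mem)
  moreover have "c ! b \<noteq> c ! (b + 2)" using dist len by (auto simp: b_def nth_eq_iff_index_eq)
  moreover have "X \<subseteq> ?L i" unfolding X_def by simp
  ultimately obtain m A where m: "1 \<le> m" "m \<le> i" and A: "A \<subseteq> X" "A \<noteq> {}" "A \<noteq> X"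
    and ps: "\<forall>x\<in>A. \<forall>y\<in>X - A. \<exists>ps. length ps = 2 * m - 1 \<and> distinct ps \<and>
      successively (adj E) (x # ps @ [y]) \<and> set ps \<subseteq> (\<Union>j<i. ?L j)"
    using bfs_tree_paths[of X E z i "c ! b" "c ! (b + 2)"] by blast
  have c_layers: "set c \<subseteq> ?L i \<union> ?L (Suc i)"
  proof
    fix w assume "w \<in> set c"
    then obtain p where "p < length c" "w = c ! p" by (metis in_set_conv_nth)
    then have "{w, c ! (Suc p mod length c)} \<in> F" using cyc unfolding is_cycle_def by simp
    then show "w \<in> ?L i \<union> ?L (Suc i)" using layers by blast
  qed
  have "has_cycle_of_length E (2 * m + l)" if l: "even l" "0 < l" "l < length c" for l
  proof -
    have "\<exists>xs. distinct xs \<and> successively (adj F) xs \<and> set xs \<subseteq> set c \<and> length xs = l + 1 \<and>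
        hd xs \<in> A \<and> last xs \<notin> A"
    proof (rule ccontr)
      assume no: "\<not> ?thesis"
      obtain x y where x: "x \<in> A" and y: "y \<in> X" "y \<notin> A" using A by blast
      then obtain p q where pq: "p < length c" "x = c ! p" "q < length c" "y = c ! q"
        using A(1) unfolding X_def by (metis IntD1 in_set_conv_nth subsetD)
      have "even p \<longleftrightarrow> even q" using alt[OF pq(1)] alt[OF pq(3)] x y A(1) pq unfolding X_def by auto
      then have "x \<in> A \<longleftrightarrow> y \<in> A"
        using cycle_with_chord_path[OF cyc chord l(2,3) _ pq(1,3), of A] no unfolding pq(2,4) by blast
      then show False using x y by simp
    qed
    then obtain xs where xs: "distinct xs" "successively (adj F) xs" "set xs \<subseteq> set c"
      "length xs = l + 1" "hd xs \<in> A" "last xs \<notin> A" by blast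
    have ne: "xs \<noteq> []" using xs(4) by auto
    have "hd xs \<in> ?L i" using xs(5) A(1) unfolding X_def by auto
    \<comment> \<open>Since \<open>l\<close> is even the path returns to layer \<open>i\<close>, so
      its end lies in \<open>X - A\<close> and a tree path to it exists.\<close>
    then have "last xs \<in> ?L i" using path_alternates[where F = F and X = "?L i" and xs = xs, OF bip] xs ne l by auto
    then have "last xs \<in> X - A" using xs ne unfolding X_def by (auto simp: subset_iff)
    then obtain qs where qs: "length qs = 2 * m - 1" "distinct qs"
      "successively (adj E) (hd xs # qs @ [last xs])" "set qs \<subseteq> (\<Union>j<i. ?L j)"
      using ps xs(5) by blast
    have qs_ne: "qs \<noteq> []" using qs(1) m by auto
    have disj: "set qs \<inter> set c = {}"
    proof (rule ccontr)
      assume "\<not> ?thesis"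
      then obtain w where w: "w \<in> set qs" "w \<in> set c" by auto
      then obtain k where "k < i" "w \<in> ?L k" using subsetD[OF qs(4)] by auto
      moreover have "w \<in> ?L i \<or> w \<in> ?L (Suc i)" using subsetD[OF c_layers w(2)] by simp
      ultimately show False using bfs_layer_disjoint[of w E z k i] bfs_layer_disjoint[of w E z k "Suc i"]
        by linarith
    qed
    have qs_succ: "successively (adj E) qs" "{hd xs, hd qs} \<in> E" "{last qs, last xs} \<in> E"
      using qs(3) qs_ne by (auto simp: successively_append_iff successively_Cons)
    have "successively (adj E) xs" by (rule successively_mono[OF xs(2)]) (use FE in auto)
    then have "successively (adj E) (xs @ rev qs)"
      using qs_succ ne by (auto simp: successively_append_iff hd_rev insert_commute)
    moreover have "distinct (xs @ rev qs)" using xs qs disj by auto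
    moreover have "{last (xs @ rev qs), hd (xs @ rev qs)} \<in> E"
      using qs_succ qs_ne ne by (simp add: last_rev insert_commute)
    moreover have "length (xs @ rev qs) = 2 * m + l" using xs(4) qs(1) m by simp
    moreover have "3 \<le> 2 * m + l" using m l by auto
    ultimately show ?thesis unfolding has_cycle_of_length_def
      by (intro exI[of _ "xs @ rev qs"] conjI is_cycleI) auto
  qed
  then show thesis using that m by blast
qed

subsection \<open>The induction\<close>

lemma has_cycle_of_length_mono: "F \<subseteq> E \<Longrightarrow> has_cycle_of_length F k \<Longrightarrow> has_cycle_of_length E k"
  unfolding has_cycle_of_length_def is_cycle_def by blast

text \<open>The constants: minimum degree \<open>32 * D * N\<close> becomes
  \<open>16 * D * N\<close> in the maximum cut, which is what
  \<open>dense_consecutive_layers\<close> needs for \<open>c = 4 * D\<close>. Two layers then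
  contain a subgraph of minimum degree \<open>4 * D\<close>, and \<open>4 * D\<close> exceeds the
  \<open>3 * D\<close> that sparsity and Posa's factor 3 permit.\<close>

lemma cycles_of_consecutive_even_lengths:
  fixes D N :: real
  assumes G: "simple_graph V E" and V: "V \<noteq> {}"
    and k: "1 \<le> k" and N: "1 \<le> N" "card V \<le> N ^ k" and D: "1 \<le> D"
    and dense: "32 * D * N * card V \<le> card E"
    and sparse: "\<And>S F. F \<subseteq> E \<Longrightarrow> simple_graph S F \<Longrightarrow> card S \<le> M \<Longrightarrow> 2 * card F \<le> D * card S"
  obtains m where "1 \<le> m" "m < k"
    "\<And>l. even l \<Longrightarrow> 0 < l \<Longrightarrow> l \<le> M \<Longrightarrow> has_cycle_of_length E (2 * m + l)"
proof -
  obtain W0 where W0: "W0 \<subseteq> V" "W0 \<noteq> {}"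
    and deg0: "\<And>v. v \<in> W0 \<Longrightarrow> 32 * D * N \<le> degree {e \<in> E. e \<subseteq> W0} v"
    using dense_graph_has_min_degree_subgraph[OF G V dense] by blast
  have G0: "simple_graph W0 {e \<in> E. e \<subseteq> W0}" using simple_graph_subgraph[OF G W0(1)] by blast
  obtain A where A: "\<And>v. degree {e \<in> E. e \<subseteq> W0} v \<le>
      2 * degree {e \<in> {e \<in> E. e \<subseteq> W0}. card (e \<inter> A) = 1} v"
    using maximum_cut[OF G0] by blast
  define F where "F = {e \<in> {e \<in> E. e \<subseteq> W0}. card (e \<inter> A) = 1}"
  have GF: "simple_graph W0 F" and FE: "F \<subseteq> E"
    using simple_graph_subgraph[OF G W0(1), of F] unfolding F_def by auto
  have degF: "4 * (4 * D) * N \<le> degree F v" if "v \<in> W0" for v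
    using deg0[OF that] A[of v] unfolding F_def by simp
  have bip: "(u \<in> A) \<noteq> (v \<in> A)" if uv: "{u, v} \<in> F" for u v
  proof -
    have "u \<noteq> v" using simple_graph_edge_vertices[OF GF uv] by simp
    moreover have "card ({u, v} \<inter> A) = 1" using uv unfolding F_def by simp
    ultimately show ?thesis by (cases "u \<in> A"; cases "v \<in> A") auto
  qed
  obtain z where z: "z \<in> W0" using W0 by blast
  have W0k: "card W0 \<le> N ^ k"
    using N(2) card_mono[OF _ W0(1)] G unfolding simple_graph_def by (meson of_nat_mono order_trans)
  have D4: "0 < 4 * D" using D by simp
  obtain i where i: "i < k" "bfs_layer F z i \<noteq> {}"
    and layers: "4 * D * card (bfs_layer F z i \<union> bfs_layer F z (Suc i))
      \<le> card {e \<in> F. e \<subseteq> bfs_layer F z i \<union> bfs_layer F z (Suc i)}"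
    by (rule dense_consecutive_layers[OF GF z _ _ N(1) k W0k D4, where A = A]) (use bip degF in blast)+
  define U where "U = bfs_layer F z i \<union> bfs_layer F z (Suc i)"
  have "U \<subseteq> W0" using bfs_layer_subset[OF GF z] unfolding U_def by blast
  then have GU: "simple_graph U {e \<in> F. e \<subseteq> U}" using simple_graph_subgraph[OF GF] by blast
  have "U \<noteq> {}" using i unfolding U_def by simp
  then obtain W where W: "W \<subseteq> U" "W \<noteq> {}"
    and degW: "\<And>v. v \<in> W \<Longrightarrow> 4 * D \<le> degree {e \<in> {e \<in> F. e \<subseteq> U}. e \<subseteq> W} v"
    using dense_graph_has_min_degree_subgraph[OF GU, of "4 * D"] layers unfolding U_def by blast
  define H where "H = {e \<in> {e \<in> F. e \<subseteq> U}. e \<subseteq> W}"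
  have GH: "simple_graph W H" unfolding H_def using simple_graph_subgraph[OF GU W(1)] by blast
  have HF: "H \<subseteq> F" unfolding H_def by blast
  have degH: "4 * D \<le> degree H v" if "v \<in> W" for v using degW[OF that] unfolding H_def .
  have "degree H v \<ge> 3" if "v \<in> W" for v using degH[OF that] D by linarith
  then obtain c j Z where cyc: "is_cycle H c" "{c ! 0, c ! j} \<in> H" "2 \<le> j" "j + 2 \<le> length c"
    and Z: "Z \<subseteq> W" "Z \<noteq> {}"
    and card_le: "card (Z \<union> {w. \<exists>z\<in>Z. {z, w} \<in> H}) \<le> 3 * card Z"
      "card (Z \<union> {w. \<exists>z\<in>Z. {z, w} \<in> H}) \<le> length c"
    using posa_rotation[OF GH W(2)] by blast
  \<comment> \<open>Otherwise \<open>S\<close> is small enough for \<open>sparse\<close>. All edges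
    at \<open>Z\<close> lie in \<open>S\<close>, so the degrees in \<open>S\<close> sum to at least
    \<open>4 * D * card Z\<close>, but \<open>sparse\<close> allows at most
    \<open>D * card S\<close>, hence at most \<open>3 * D * card Z\<close>.\<close>
  have "M < length c"
  proof (rule ccontr)
    assume short: "\<not> ?thesis"
    define S where "S = Z \<union> {w. \<exists>z\<in>Z. {z, w} \<in> H}"
    let ?FS = "{e \<in> H. e \<subseteq> S}"
    have SW: "S \<subseteq> W" unfolding S_def using Z simple_graph_edge_vertices[OF GH] by blast
    have GS: "simple_graph S ?FS" using simple_graph_subgraph[OF GH SW] by blast
    have finS: "finite S" using GS unfolding simple_graph_def by simp
    have finZ: "finite Z" using finS unfolding S_def by simp
    have same: "degree H x = degree ?FS x" if x: "x \<in> Z" for x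
    proof -
      have "e \<subseteq> S" if e: "e \<in> H" "x \<in> e" for e
        using simple_graph_edge[OF GH e] e x unfolding S_def by blast
      then have "{e \<in> H. x \<in> e} = {e \<in> ?FS. x \<in> e}" by auto
      then show ?thesis unfolding degree_def by simp
    qed
    have "card Z * (4 * D) \<le> (\<Sum>x\<in>Z. real (degree H x))"
      using sum_bounded_below[of Z "4 * D" "\<lambda>x. real (degree H x)"] degH Z(1) by auto
    also have "\<dots> = (\<Sum>x\<in>Z. real (degree ?FS x))" using same by simp
    also have "\<dots> \<le> (\<Sum>x\<in>S. real (degree ?FS x))"
      using finS by (intro sum_mono2) (auto simp: S_def)
    also have "\<dots> = real (2 * card ?FS)" using handshake[OF GS] by (simp flip: of_nat_sum)
    also have "\<dots> \<le> D * card S"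
      using sparse[of ?FS S] GS HF FE short card_le(2) unfolding S_def by force
    also have "\<dots> \<le> D * (3 * card Z)"
      using card_le(1) D unfolding S_def by (intro mult_left_mono) auto
    finally have "card Z * D \<le> 0" by (simp add: algebra_simps)
    then show False using D finZ Z(2) by (simp add: mult_le_0_iff)
  qed
  have layerH: "u \<in> bfs_layer F z i \<and> v \<in> bfs_layer F z (Suc i) \<or>
      v \<in> bfs_layer F z i \<and> u \<in> bfs_layer F z (Suc i)" if uv: "{u, v} \<in> H" for u v
  proof -
    have "u \<in> U" "v \<in> U" using uv unfolding H_def by auto
    moreover have "(u \<in> A) \<noteq> (v \<in> A)" using bip uv HF by blast
    ultimately show ?thesis unfolding U_def
      using bfs_layer_parity[where E = F and A = A and z = z, OF bip] by blast
  qed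
  obtain m where m: "1 \<le> m" "m \<le> i"
    and cycles: "\<And>l. even l \<Longrightarrow> 0 < l \<Longrightarrow> l < length c \<Longrightarrow> has_cycle_of_length F (2 * m + l)"
    using cycles_through_bfs_tree[OF HF layerH cyc] by blast
  show thesis
  proof (rule that)
    show "has_cycle_of_length E (2 * m + l)" if "even l" "0 < l" "l \<le> M" for l
      using has_cycle_of_length_mono[OF FE cycles] that \<open>M < length c\<close> by simp
  qed (use m i in auto)
qed

lemma card_edges_le_square:
  assumes "simple_graph V E"
  shows "2 * card E \<le> card V * card V"
proof -
  have "degree E v \<le> card V" for v
  proof -
    have "{e \<in> E. v \<in> e} \<subseteq> (\<lambda>u. {v, u}) ` V"
    proof
      fix e assume "e \<in> {e \<in> E. v \<in> e}"
      then have e: "e \<in> E" "v \<in> e" by auto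
      show "e \<in> (\<lambda>u. {v, u}) ` V" by (rule simple_graph_edge[OF assms e]) blast
    qed
    then show ?thesis unfolding degree_def
      using assms surj_card_le[of V] unfolding simple_graph_def by blast
  qed
  then have "(\<Sum>v\<in>V. degree E v) \<le> (\<Sum>v\<in>V. card V)" by (intro sum_mono)
  then show ?thesis using handshake[OF assms] by simp
qed

text \<open>This includes \<open>n = 0\<close> because \<open>ln 0 = 0\<close>.\<close>

lemma ln_real_of_nat_nonneg: "0 \<le> ln (real n)"
  by (cases n) auto

lemma infinite_subsequence_pos:
  assumes "infinite_subsequence \<pi> \<sigma>" "\<forall>i\<ge>1. \<sigma> i > 0 \<and> even (\<sigma> i)" "i \<ge> 1"
  shows "\<pi> i > 0"
proof -
  obtain f where "\<forall>i\<ge>1. f i \<ge> 1 \<and> \<pi> i = \<sigma> (f i)"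
    using assms(1) unfolding infinite_subsequence_def by blast
  then show ?thesis using assms(2,3) by metis
qed

text \<open>A counterexample would contain cycles of all even lengths above \<open>2 * m\<close> up
  to \<open>2 * m + M\<close>, for some \<open>m\<close> with \<open>2 * m < \<pi> r\<close>. The
  first term of \<open>\<sigma>\<close> above \<open>2 * m\<close> is among them, as the gaps of
  \<open>\<sigma>\<close> up to \<open>\<pi> r\<close> are at most
  \<open>Delta \<sigma> \<pi> r\<close>.\<close>

lemma average_degree_step:
  fixes D :: real
  assumes mono: "strict_mono_on {1..} \<sigma>" and ev: "\<forall>i\<ge>1. \<sigma> i > 0 \<and> even (\<sigma> i)"
    and sub: "infinite_subsequence \<pi> \<sigma>"
    and G: "simple_graph V E" and V: "V \<noteq> {}"
    and free: "\<forall>i\<ge>1. \<not> has_cycle_of_length E (\<sigma> i)"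
    and r: "r \<ge> 1" and D: "\<pi> 1 \<le> D"
    and small: "\<And>S F. F \<subseteq> E \<Longrightarrow> simple_graph S F \<Longrightarrow> card S \<le> Delta \<sigma> \<pi> r \<Longrightarrow> 2 * card F \<le> D * card S"
  shows "average_degree V E \<le> exp 6 * D * exp (2 * ln (card V) / \<pi> r)"
proof (rule ccontr)
  assume big: "\<not> ?thesis"
  obtain f where f: "strict_mono_on {1..} f" "\<And>i. i \<ge> 1 \<Longrightarrow> f i \<ge> 1 \<and> \<pi> i = \<sigma> (f i)"
    using sub unfolding infinite_subsequence_def by blast
  have mono_le: "\<sigma> a \<le> \<sigma> b" if "1 \<le> a" "a \<le> b" for a b
    using strict_mono_onD[OF mono, of a b] that by (cases "a = b") auto
  have \<pi>1: "1 \<le> \<pi> 1" using infinite_subsequence_pos[OF sub ev, of 1] by simp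
  have \<pi>r: "\<pi> r = \<sigma> (f r)" "1 \<le> f r" using f(2) r by auto
  have "\<sigma> 1 \<le> \<pi> 1" using f(2)[of 1] mono_le by simp
  define k where "k = \<pi> r div 2"
  have \<pi>k: "\<pi> r = 2 * k" and k: "1 \<le> k" using ev \<pi>r unfolding k_def by (auto elim!: evenE)
  define N where "N = exp (ln (card V) / k)"
  have V0: "card V > 0" using G V unfolding simple_graph_def by (simp add: card_gt_0_iff)
  have N1: "1 \<le> N" unfolding N_def using ln_real_of_nat_nonneg k by simp
  have "N ^ k = exp (of_nat k * (ln (card V) / k))" unfolding N_def by (rule exp_of_nat_mult[symmetric])
  also have "\<dots> = card V" using k V0 by simp
  finally have Nk: "card V \<le> N ^ k" by simp
  have D1: "1 \<le> D" using D \<pi>1 by linarith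
  \<comment> \<open>The 6 in the exponent pays for a factor 64: average degree above
    \<open>64 * D * N\<close> means more than \<open>32 * D * N * card V\<close> edges.\<close>
  have "64 = (2::real) ^ 6" by simp
  also have "\<dots> \<le> exp 1 ^ 6" using exp_ge_add_one_self[of 1] by (intro power_mono) auto
  also have "\<dots> = exp 6" by (simp flip: exp_of_nat_mult)
  finally have "64 * (D * N) \<le> exp 6 * (D * N)" using D1 N1 by (intro mult_right_mono) auto
  also have "\<dots> = exp 6 * D * exp (2 * ln (card V) / \<pi> r)"
    unfolding N_def \<pi>k by simp
  also have "\<dots> < 2 * card E / card V" using big unfolding average_degree_def by simp
  finally have dense: "32 * D * N * card V \<le> card E" using V0 by (simp add: field_simps)
  \<comment> \<open>The term \<open>\<pi> 1\<close> takes care of \<open>j = 1\<close> below, where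
    \<open>\<sigma> j\<close> has no predecessor. On at most \<open>\<pi> 1\<close> vertices
    sparsity is trivial since \<open>\<pi> 1 \<le> D\<close>.\<close>
  define M where "M = max (Delta \<sigma> \<pi> r) (\<pi> 1)"
  have sparse: "2 * card F \<le> D * card S" if F: "F \<subseteq> E" "simple_graph S F" "card S \<le> M" for S F
  proof (cases "card S \<le> Delta \<sigma> \<pi> r")
    case False
    then have "real (card S) \<le> D" using F(3) D unfolding M_def by simp
    then have "real (card S) * card S \<le> D * card S" by (intro mult_right_mono) auto
    moreover have "real (2 * card F) \<le> real (card S * card S)"
      using card_edges_le_square[OF F(2)] by (simp only: of_nat_le_iff)
    ultimately show ?thesis by simp
  qed (use small F in blast)
  obtain m where m: "1 \<le> m" "m < k"
    and cycles: "\<And>l. even l \<Longrightarrow> 0 < l \<Longrightarrow> l \<le> M \<Longrightarrow> has_cycle_of_length E (2 * m + l)"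
    using cycles_of_consecutive_even_lengths[OF G V k N1 Nk D1 dense sparse] by blast
  \<comment> \<open>By minimality \<open>\<sigma> (j - 1)\<close> is at most \<open>2 * m\<close>
    when \<open>j \<ge> 2\<close>, so \<open>\<sigma> j\<close> exceeds \<open>2 * m\<close> by at
    most one gap of \<open>\<sigma>\<close>.\<close>
  define j where "j = (LEAST j. 1 \<le> j \<and> 2 * m < \<sigma> j)"
  have fr: "1 \<le> f r \<and> 2 * m < \<sigma> (f r)" using \<pi>r \<pi>k m by simp
  have j: "1 \<le> j" "2 * m < \<sigma> j" "j \<le> f r"
    using LeastI[of "\<lambda>j. 1 \<le> j \<and> 2 * m < \<sigma> j", OF fr]
      Least_le[of "\<lambda>j. 1 \<le> j \<and> 2 * m < \<sigma> j", OF fr] unfolding j_def by auto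
  have j\<pi>: "\<sigma> j \<le> \<pi> r" using mono_le[OF j(1,3)] \<pi>r by simp
  have "\<sigma> j - 2 * m \<le> M"
  proof (cases "j = 1 \<or> r = 1")
    case True
    then show ?thesis using \<open>\<sigma> 1 \<le> \<pi> 1\<close> j\<pi> unfolding M_def by auto
  next
    case False
    then have j2: "2 \<le> j" "r \<noteq> 1" using j(1) by auto
    have "\<not> 2 * m < \<sigma> (j - 1)"
      using not_less_Least[of "j - 1" "\<lambda>j. 1 \<le> j \<and> 2 * m < \<sigma> j"] j2 unfolding j_def[symmetric] by auto
    then have "\<sigma> j - 2 * m \<le> \<sigma> j - \<sigma> (j - 1)" by simp
    also have "\<dots> \<le> Max {\<sigma> j - \<sigma> (j - 1) | j. j \<ge> 2 \<and> \<sigma> j \<le> \<pi> r}"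
    proof (rule Max_ge)
      show "finite {\<sigma> j - \<sigma> (j - 1) | j. j \<ge> 2 \<and> \<sigma> j \<le> \<pi> r}"
        by (rule finite_subset[of _ "{..\<pi> r}"]) auto
    qed (use j2 j\<pi> in blast)
    also have "\<dots> = Delta \<sigma> \<pi> r" using j2 unfolding Delta_def by simp
    finally show ?thesis unfolding M_def by simp
  qed
  then have "has_cycle_of_length E (2 * m + (\<sigma> j - 2 * m))"
    using j(1,2) ev by (intro cycles) auto
  then show False using free j by simp
qed

section \<open>The bound as a function of \<open>r\<close>, and the induction on
  \<open>r\<close>\<close>

lemma degree_bound_1: "degree_bound n \<sigma> \<pi> 1 = exp 6 * exp (2 * ln (\<pi> 1)) * exp (2 * ln n / \<pi> 1)"
  unfolding degree_bound_def by (simp add: Delta_def exp_add)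

text \<open>The last summand has denominator \<open>\<pi> r\<close>, so it is the \<open>n\<close>
  term of the bound for \<open>r\<close> at \<open>n = Delta \<sigma> \<pi> (Suc r)\<close>. For
  \<open>r = 0\<close> the denominator would be the convention 1.\<close>

lemma degree_bound_Suc:
  "r \<ge> 1 \<Longrightarrow> degree_bound n \<sigma> \<pi> (Suc r)
    = exp 6 * degree_bound (Delta \<sigma> \<pi> (Suc r)) \<sigma> \<pi> r * exp (2 * ln n / \<pi> (Suc r))"
  unfolding degree_bound_def by (simp add: exp_add algebra_simps)

lemma degree_bound_mono: "0 < a \<Longrightarrow> a \<le> b \<Longrightarrow> degree_bound a \<sigma> \<pi> r \<le> degree_bound b \<sigma> \<pi> r"
  unfolding degree_bound_def by (auto intro!: divide_right_mono)

text \<open>The summand for \<open>i = 1\<close> alone is twice \<open>ln (\<pi> 1)\<close> and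
  nothing else is negative. This supplies the hypothesis \<open>\<pi> 1 \<le> D\<close> of
  \<open>average_degree_step\<close>.\<close>

lemma first_term_le_degree_bound:
  assumes "r \<ge> 1" "\<pi> 1 > 0"
  shows "\<pi> 1 \<le> degree_bound n \<sigma> \<pi> r"
proof -
  let ?t = "\<lambda>i. 2 * ln (real (Delta \<sigma> \<pi> i)) / real ((\<pi>(0 := 1)) (i - 1))"
  have "ln (\<pi> 1) \<le> ?t 1" using ln_real_of_nat_nonneg[of "\<pi> 1"] by (simp add: Delta_def)
  also have "\<dots> \<le> (\<Sum>i=1..r. ?t i)"
    using assms ln_real_of_nat_nonneg by (intro member_le_sum) auto
  also have "\<dots> \<le> 6 * real r + (\<Sum>i=1..r. ?t i) + 2 * ln n / \<pi> r"
    using ln_real_of_nat_nonneg[of n] by simp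
  finally have "exp (ln (\<pi> 1)) \<le> degree_bound n \<sigma> \<pi> r"
    unfolding degree_bound_def by (simp only: exp_le_cancel_iff)
  then show ?thesis using assms(2) by simp
qed

text \<open>The graph is generalised because the induction hypothesis is applied to subgraphs on at
  most \<open>Delta \<sigma> \<pi> (Suc r)\<close> vertices. In the base case \<open>D\<close> is
  the square of \<open>\<pi> 1\<close>, and sparsity is the trivial bound on the number of
  edges.\<close>

lemma average_degree_le_degree_bound:
  assumes mono: "strict_mono_on {1..} \<sigma>" and ev: "\<forall>i\<ge>1. \<sigma> i > 0 \<and> even (\<sigma> i)"
    and sub: "infinite_subsequence \<pi> \<sigma>" and r: "r \<ge> 1"
  shows "simple_graph V E \<Longrightarrow> \<forall>i\<ge>1. \<not> has_cycle_of_length E (\<sigma> i) \<Longrightarrow>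
    average_degree V E \<le> degree_bound (card V) \<sigma> \<pi> r"
  using r
proof (induction r arbitrary: V E rule: dec_induct)
  case base
  have \<pi>1: "\<pi> 1 > 0" using infinite_subsequence_pos[OF sub ev, of 1] by simp
  have D: "exp (2 * ln (real (\<pi> 1))) = real (\<pi> 1) * real (\<pi> 1)"
    using \<pi>1 by (simp add: exp_double power2_eq_square)
  have le: "real (\<pi> 1) \<le> real (\<pi> 1) * real (\<pi> 1)" using \<pi>1 by simp
  \<comment> \<open>For empty \<open>V\<close> the average degree is 0, by division by zero.\<close>
  show ?case
  proof (cases "V = {}")
    case False
    show ?thesis unfolding degree_bound_1
    proof (rule average_degree_step[OF mono ev sub base(1) False base(2)])
      fix S :: "'a set" and F assume S: "simple_graph S F" "card S \<le> Delta \<sigma> \<pi> 1"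
      have "real (2 * card F) \<le> real (card S * card S)"
        using card_edges_le_square[OF S(1)] by (simp only: of_nat_le_iff)
      also have "\<dots> \<le> real (\<pi> 1) * card S" using S(2) by (simp add: Delta_def mult_right_mono)
      also have "\<dots> \<le> exp (2 * ln (\<pi> 1)) * card S"
        using le unfolding D by (intro mult_right_mono) auto
      finally show "real (2 * card F) \<le> exp (2 * ln (\<pi> 1)) * card S" .
    qed (use le D in auto)
  qed (simp add: average_degree_def degree_bound_def)
next
  case (step r)
  have \<pi>1: "\<pi> 1 > 0" using infinite_subsequence_pos[OF sub ev, of 1] by simp
  show ?case
  proof (cases "V = {}")
    case False
    show ?thesis unfolding degree_bound_Suc[OF step.hyps(1)]
    proof (rule average_degree_step[OF mono ev sub step.prems(1) False step.prems(2)])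
      fix S :: "'a set" and F
      assume S: "F \<subseteq> E" "simple_graph S F" "card S \<le> Delta \<sigma> \<pi> (Suc r)"
      show "real (2 * card F) \<le> degree_bound (Delta \<sigma> \<pi> (Suc r)) \<sigma> \<pi> r * card S"
      proof (cases "S = {}")
        case True
        then show ?thesis using card_edges_le_square[OF S(2)] by simp
      next
        case False
        then have S0: "card S > 0" using S(2) unfolding simple_graph_def by (simp add: card_gt_0_iff)
        have "average_degree S F \<le> degree_bound (card S) \<sigma> \<pi> r"
          using S(1) step.prems(2) has_cycle_of_length_mono by (intro step.IH[OF S(2)]) blast
        also have "\<dots> \<le> degree_bound (Delta \<sigma> \<pi> (Suc r)) \<sigma> \<pi> r"
          using S0 S(3) by (rule degree_bound_mono)
        finally show ?thesis using S0 unfolding average_degree_def by (simp add: divide_le_eq)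
      qed
    qed (use step.hyps first_term_le_degree_bound[of _ \<pi>] \<pi>1 in auto)
  qed (simp add: average_degree_def degree_bound_def)
qed

theorem theorem1p3:
  fixes \<sigma> :: "nat \<Rightarrow> nat" and V :: "'a set" and E :: "'a set set" and n :: nat
  assumes "strict_mono_on {1..} \<sigma>"
    and "\<forall>i\<ge>1. \<sigma> i > 0 \<and> even (\<sigma> i)"
    and "simple_graph V E"
    and "card V = n"
    and "\<forall>i\<ge>1. \<not> has_cycle_of_length E (\<sigma> i)"
  shows "average_degree V E
    \<le> (INF (\<pi>, r) \<in> {(\<pi>, r). infinite_subsequence \<pi> \<sigma> \<and> r \<ge> 1}. degree_bound n \<sigma> \<pi> r)"
proof (rule cInf_greatest)
  \<comment> \<open>The infimum over the reals is meaningful only for a nonempty set;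
    \<open>\<sigma>\<close> itself with \<open>r = 1\<close> is a member of the index set.\<close>
  have "infinite_subsequence \<sigma> \<sigma>"
    unfolding infinite_subsequence_def by (intro exI[of _ id]) (auto simp: strict_mono_on_def)
  then have "(\<sigma>, 1) \<in> {(\<pi>, r :: nat). infinite_subsequence \<pi> \<sigma> \<and> r \<ge> 1}" by simp
  then show "(\<lambda>(\<pi>, r). degree_bound n \<sigma> \<pi> r) ` {(\<pi>, r). infinite_subsequence \<pi> \<sigma> \<and> r \<ge> 1} \<noteq> {}"
    by (metis empty_iff image_is_empty)
next
  fix b assume "b \<in> (\<lambda>(\<pi>, r). degree_bound n \<sigma> \<pi> r) ` {(\<pi>, r). infinite_subsequence \<pi> \<sigma> \<and> r \<ge> 1}"
  then obtain \<pi> r where "b = degree_bound n \<sigma> \<pi> r" "infinite_subsequence \<pi> \<sigma>" "r \<ge> 1" by auto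
  then show "average_degree V E \<le> b"
    using average_degree_le_degree_bound[OF assms(1,2) _ _ assms(3,5)] assms(4) by simp
qed

end
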